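(* Let $m\in\mathbb{N}$ and consider the Weighted Recursive Graph $(\mathcal{G}_n)_{n\in\mathbb{N}}$ with out-degree $m$ and vertex-weights $(W_i)_{i\in\mathbb{N}}$ that are i.i.d. copies of a positive random variable $W$ with $\sup\{x>0:\mathbb{P}(W\le x)<1\}=1$. Let $\theta_m:=1+\mathbb{E}[W]/m$ and let $I_n:=\inf\{i\in[n]: \mathcal{Z}_n(i)\ge \mathcal{Z}_n(j)\text{ for all }j\in[n]\}$ be the smallest label of a vertex attaining the maximum in-degree in $\mathcal{G}_n$. Then, as $n\to\infty$, $$\frac{\log I_n}{\log n}\longrightarrow \mu_m:=1-\frac{\theta_m-1}{\theta_m\log\theta_m}\qquad\text{almost surely.}$$
   Context: Notation: $[n]=\{1,\dots,n\}$. Weighted Recursive Graph (WRG) with out-degree $m\in\mathbb{N}$: let $(W_i)_{i\ge1}$ be i.i.d. copies of a random variable $W$ with $\mathbb{P}(W>0)=1$, and let $S_n:=\sum_{i=1}^nW_i$. $\mathcal{G}_1$ consists of a single vertex $1$ (the root) with vertex-weight $W_1$. For $n\ge1$, a new vertex $n+1$ with vertex-weight $W_{n+1}$ and $m$ half-edges is added; conditionally on $\mathcal{G}_n$ (and the weights), each of the $m$ half-edges is independently connected to a vertex $i\in[n]$ chosen with probability $W_i/S_n$. The resulting graph is $\mathcal{G}_{n+1}$ (a multigraph, edges directed from new vertices to old vertices). $\mathcal{Z}_n(i)$ denotes the in-degree of vertex $i$ in $\mathcal{G}_n$ (counted with multiplicity). *)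

theory Defs
  imports "HOL-Probability.Probability" "Graph_Theory.Digraph"
begin

text \<open>
  \<open>W i\<close> is the weight of vertex \<open>i \<ge> 1\<close>, and \<open>X k l\<close> is the vertex that half-edge
  \<open>l \<in> {1..m}\<close> of vertex \<open>k \<ge> 2\<close> is connected to. Values at other indices play no role.
\<close>

definition total_weight :: "(nat \<Rightarrow> 'a \<Rightarrow> real) \<Rightarrow> nat \<Rightarrow> 'a \<Rightarrow> real" where
  "total_weight W n \<omega> = (\<Sum>i=1..n. W i \<omega>)"

text \<open>
  The multigraph on \<open>{1..n}\<close>; the arc \<open>(k, l)\<close> is half-edge \<open>l\<close> of vertex \<open>k\<close>, so
  parallel arcs are distinguished and \<^const>\<open>in_degree\<close> counts multiplicities.
\<close>

definition wrg_graph ::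
    "nat \<Rightarrow> (nat \<Rightarrow> nat \<Rightarrow> 'a \<Rightarrow> nat) \<Rightarrow> nat \<Rightarrow> 'a \<Rightarrow> (nat, nat \<times> nat) pre_digraph" where
  "wrg_graph m X n \<omega> =
     \<lparr> verts = {1..n}, arcs = {2..n} \<times> {1..m}, tail = fst, head = (\<lambda>(k, l). X k l \<omega>) \<rparr>"

definition max_degree_label ::
    "nat \<Rightarrow> (nat \<Rightarrow> nat \<Rightarrow> 'a \<Rightarrow> nat) \<Rightarrow> nat \<Rightarrow> 'a \<Rightarrow> nat" where
  "max_degree_label m X n \<omega> =
     Inf {i \<in> {1..n}. \<forall>j\<in>{1..n}.
       in_degree (wrg_graph m X n \<omega>) i \<ge> in_degree (wrg_graph m X n \<omega>) j}"

text \<open>The \<open>\<sigma>\<close>-algebra generated by all the vertex-weights and the graph at time \<open>n\<close>.\<close>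

definition wrg_history ::
    "'a measure \<Rightarrow> nat \<Rightarrow> (nat \<Rightarrow> 'a \<Rightarrow> real) \<Rightarrow> (nat \<Rightarrow> nat \<Rightarrow> 'a \<Rightarrow> nat) \<Rightarrow> nat \<Rightarrow> 'a measure" where
  "wrg_history M m W X n = sigma (space M)
     ({W i -` B \<inter> space M | i B. i \<ge> 1 \<and> B \<in> sets borel} \<union>
      {X k l -` {j} \<inter> space M | k l j. k \<in> {2..n} \<and> l \<in> {1..m}})"

text \<open>
  The random variable \<open>V\<close> on \<open>N\<close> is the generic vertex-weight, of which the weights
  \<open>W i\<close> on \<open>M\<close> are i.i.d. copies.
  In \<open>attach\<close>, the assignment \<open>v\<close> lists target vertices for the half-edges of vertex
  \<open>n + 1\<close>; the product form of the joint conditional probability says that the half-edges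
  are conditionally independent, each choosing vertex \<open>i\<close> with probability \<open>W i / S n\<close>.
\<close>

locale weighted_recursive_graph = M: prob_space M + N: prob_space N
  for M :: "'a measure" and N :: "'b measure" +
  fixes V :: "'b \<Rightarrow> real" and m :: nat
    and W :: "nat \<Rightarrow> 'a \<Rightarrow> real" and X :: "nat \<Rightarrow> nat \<Rightarrow> 'a \<Rightarrow> nat"
  assumes V_measurable: "V \<in> borel_measurable N"
    and V_pos: "AE x in N. V x > 0"
    and m_pos: "m \<ge> 1"
    and W_indep: "M.indep_vars (\<lambda>_. borel) W {1..}"
    and W_copies: "\<And>i. i \<ge> 1 \<Longrightarrow> distr M borel (W i) = distr N borel V"
    and X_measurable: "\<And>n l. n \<ge> 1 \<Longrightarrow> l \<in> {1..m} \<Longrightarrow> X (n + 1) l \<in> M \<rightarrow>\<^sub>M count_space {1..n}"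
    and attach: "\<And>n v. n \<ge> 1 \<Longrightarrow> v \<in> {1..m} \<rightarrow> {1..n} \<Longrightarrow>
      AE \<omega> in M. real_cond_exp M (wrg_history M m W X n)
          (indicator {\<omega> \<in> space M. \<forall>l\<in>{1..m}. X (n + 1) l \<omega> = v l}) \<omega>
        = (\<Prod>l=1..m. W (v l) \<omega> / total_weight W n \<omega>)"
begin

lemma subalgebra_wrg_history: "subalgebra M (wrg_history M m W X n)"
proof -
  have W: "W i \<in> borel_measurable M" if "i \<ge> 1" for i
    using W_indep that unfolding M.indep_vars_def by auto
  have X: "X k l -` {j} \<inter> space M \<in> sets M" if "k \<in> {2..n}" "l \<in> {1..m}" for k l j
  proof -
    have m: "X k l \<in> M \<rightarrow>\<^sub>M count_space {1..k - 1}"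
      using X_measurable[of "k - 1" l] that by auto
    have "X k l -` {j} \<inter> space M = X k l -` ({j} \<inter> {1..k - 1}) \<inter> space M"
      using measurable_space[OF m] by auto
    then show ?thesis
      using measurable_sets[OF m, of "{j} \<inter> {1..k - 1}"] by simp
  qed
  let ?G = "{W i -` B \<inter> space M | i B. i \<ge> 1 \<and> B \<in> sets borel} \<union>
      {X k l -` {j} \<inter> space M | k l j. k \<in> {2..n} \<and> l \<in> {1..m}}"
  have G: "?G \<subseteq> sets M"
    using measurable_sets[OF W] X by blast
  have Pow: "?G \<subseteq> Pow (space M)"
    by blast
  have "sets (wrg_history M m W X n) = sigma_sets (space M) ?G"
    unfolding wrg_history_def by (rule sets_measure_of[OF Pow])
  moreover have "sigma_sets (space M) ?G \<subseteq> sets M"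
    by (rule sets.sigma_sets_subset[OF G])
  moreover have "space (wrg_history M m W X n) = space M"
    unfolding wrg_history_def by (rule space_measure_of[OF Pow])
  ultimately show ?thesis
    unfolding subalgebra_def by simp
qed

end

definition weight_theta :: "'b measure \<Rightarrow> ('b \<Rightarrow> real) \<Rightarrow> nat \<Rightarrow> real" where
  "weight_theta N V m = 1 + (LINT x|N. V x) / real m"

definition weight_mu :: "'b measure \<Rightarrow> ('b \<Rightarrow> real) \<Rightarrow> nat \<Rightarrow> real" where
  "weight_mu N V m =
     1 - (weight_theta N V m - 1) / (weight_theta N V m * ln (weight_theta N V m))"

end

(*
  Conditionally on the weights, the half-edges are independent, so
  E[t^(in-degree of i)] = prod_k (1 + (t - 1) W_i / S_k)^m, which for t >= 1 is at most about
  (n / i)^((t - 1) / (theta - 1)) by the law of large numbers, with near equality when W_i is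
  close to 1. Markov's inequality at t = theta gives P(degree of i >= ln n / ln theta) <= 1 / i up
  to n^o(1), i.e. an expected number of n^o(1) such vertices at every scale i = n^beta; as the
  exponent is stationary in t at t = theta only when beta = mu, a slightly smaller t (for beta < mu)
  or larger t (for beta > mu) gains a power of n, uniformly over the scales on that side of mu.
  Conversely, for heavy vertices near n^mu, comparing the generating function at three nearby
  values of t shows that it is carried by degrees in a small window, which bounds from below the
  probability of a degree of at least (1 - eta) ln n / ln theta; the events are negatively
  correlated, so Chebyshev's inequality shows that one of them occurs. All error probabilities are
  summable along n = 2^j, and degrees are monotone in n.
*)
theory Submission
  imports Defs "HOL-Real_Asymp.Real_Asymp"
begin

section \<open>Label counts under product laws\<close>

text \<open>For a fixed weight sequence the estimates have constants that depend on how fast its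
  averages converge, with no bound uniform over all sequences, so failure probabilities averaged
  over the weights need not be summable. Hence the estimates are proved for the product law given by
  one sequence, and the transfer to \<open>M\<close> is a Borel-Cantelli argument conditional on the
  weights. The size of the maximum is never located exactly. Labels beyond \<open>n^\<beta>\<close>
  on the side away from \<open>n^\<mu>\<close> stay below
  \<open>(1 - \<eta>) ln n / ln \<theta>\<close> for some \<eta> > 0 depending on \<beta>, whereas
  some vertex reaches this level for every \<eta> in (0, 1). Using a strictly smaller \<eta> for the
  latter leaves a gap proportional to \<open>ln n\<close>, which absorbs the bounded change of the
  level between \<open>2^j\<close> and \<open>2^(j+1)\<close>. Taking \<beta> rational and \<eta> a
  reciprocal keeps the exceptional null sets countable in number.\<close>

definition count_label :: "'a set \<Rightarrow> ('a \<Rightarrow> 'b) \<Rightarrow> 'b \<Rightarrow> nat" where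
  "count_label A x i = card {a \<in> A. x a = i}"

lemma count_label_insert:
  assumes "finite A" "a \<notin> A"
  shows "count_label (insert a A) (x(a := y)) i = count_label A x i + of_bool (y = i)"
proof -
  have "{b \<in> insert a A. (x(a := y)) b = i} =
      (if y = i then insert a {b \<in> A. x b = i} else {b \<in> A. x b = i})"
    using assms by auto
  then show ?thesis
    using assms by (simp add: count_label_def)
qed

lemma count_label_eq_sum:
  assumes "finite A"
  shows "count_label A x i = (\<Sum>a\<in>A. of_bool (x a = i))"
proof -
  have "(\<Sum>a\<in>A. of_bool (x a = i) :: nat) = card (A \<inter> {a. x a = i})"
    using assms by (simp add: sum_of_bool_eq)
  then show ?thesis
    by (simp add: count_label_def Int_def)
qed

text \<open>The power is a product of functions of the independent labels, each equal to t or
  1.\<close>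

lemma expectation_power_count_label:
  fixes t :: real
  assumes "finite A" "t \<ge> 0"
  shows "measure_pmf.expectation (Pi_pmf A d p) (\<lambda>x. t ^ count_label A x i) =
    (\<Prod>a\<in>A. 1 + (t - 1) * pmf (p a) i)"
proof -
  have "t ^ count_label A x i = (\<Prod>a\<in>A. t ^ of_bool (x a = i))" for x
    unfolding count_label_eq_sum[OF assms(1)] by (rule power_sum)
  moreover have "t ^ of_bool (y = i) = 1 + (t - 1) * indicat_real {i} y" for y
    by (auto simp: indicator_def)
  ultimately have "measure_pmf.expectation (Pi_pmf A d p) (\<lambda>x. t ^ count_label A x i) =
      measure_pmf.expectation (Pi_pmf A d p) (\<lambda>x. \<Prod>a\<in>A. t ^ of_bool (x a = i))"
    by simp
  also have "\<dots> = (\<Prod>a\<in>A. measure_pmf.expectation (p a) (\<lambda>y. t ^ of_bool (y = i)))"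
  proof (rule expectation_prod_Pi_pmf[OF assms(1)])
    show "integrable (measure_pmf (p a)) (\<lambda>y. t ^ of_bool (y = i))" for a
      by (rule measure_pmf.integrable_const_bound[where B = "max 1 t"]) (auto simp: assms)
  qed (use assms in auto)
  also have "\<dots> = (\<Prod>a\<in>A. 1 + (t - 1) * pmf (p a) i)"
  proof (rule prod.cong[OF refl])
    fix a
    have "measure_pmf.expectation (p a) (\<lambda>y. t ^ of_bool (y = i)) =
        measure_pmf.expectation (p a) (\<lambda>y. 1 + (t - 1) * indicat_real {i} y)"
      by (rule Bochner_Integration.integral_cong) (auto simp: indicator_def)
    also have "\<dots> = 1 + (t - 1) * pmf (p a) i"
      by (subst Bochner_Integration.integral_add)
        (auto simp: measure_pmf_single intro!: measure_pmf.integrable_const_bound[where B = 1])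
    finally show "measure_pmf.expectation (p a) (\<lambda>y. t ^ of_bool (y = i)) = 1 + (t - 1) * pmf (p a) i" .
  qed
  finally show ?thesis .
qed

lemma finite_set_Pi_pmf:
  assumes "finite A" "\<And>a. a \<in> A \<Longrightarrow> finite (set_pmf (p a))"
  shows "finite (set_pmf (Pi_pmf A d p))"
  using assms by (auto simp: set_Pi_pmf intro!: finite_PiE_dflt)

text \<open>Fubini for one coordinate. Finite supports make every real function integrable.\<close>

lemma expectation_Pi_pmf_insert:
  fixes h :: "('a \<Rightarrow> 'b) \<Rightarrow> real"
  assumes "finite A" "a \<notin> A" and fin: "\<And>b. b \<in> insert a A \<Longrightarrow> finite (set_pmf (p b))"
  shows "measure_pmf.expectation (Pi_pmf (insert a A) d p) h =
    measure_pmf.expectation (p a) (\<lambda>y. measure_pmf.expectation (Pi_pmf A d p) (\<lambda>x. h (x(a := y))))"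
proof -
  have finA: "finite (set_pmf (Pi_pmf A d p))"
    using assms by (intro finite_set_Pi_pmf) auto
  have "Pi_pmf (insert a A) d p = p a \<bind> (\<lambda>y. map_pmf (\<lambda>x. x(a := y)) (Pi_pmf A d p))"
    using assms by (simp add: Pi_pmf_insert' map_pmf_def)
  also have "measure_pmf.expectation \<dots> h =
      (\<Sum>y\<in>set_pmf (p a). pmf (p a) y *\<^sub>R
         measure_pmf.expectation (map_pmf (\<lambda>x. x(a := y)) (Pi_pmf A d p)) h)"
    using fin finA by (intro pmf_expectation_bind) auto
  also have "\<dots> = measure_pmf.expectation (p a)
      (\<lambda>y. measure_pmf.expectation (Pi_pmf A d p) (\<lambda>x. h (x(a := y))))"
    using fin by (subst integral_measure_pmf[where A = "set_pmf (p a)"]) auto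
  finally show ?thesis .
qed

text \<open>A single label cannot equal both i and j, so the contributions of one coordinate to the
  two counts are negatively correlated. The induction treats all monotone f and g at once, because
  fixing the label of the new coordinate shifts their arguments.\<close>

lemma count_label_negative_correlation:
  fixes f g :: "nat \<Rightarrow> real"
  assumes "finite A" "\<And>a. a \<in> A \<Longrightarrow> finite (set_pmf (p a))" and ij: "i \<noteq> j"
    and "mono f" "mono g"
  shows "measure_pmf.expectation (Pi_pmf A d p) (\<lambda>x. f (count_label A x i) * g (count_label A x j))
    \<le> measure_pmf.expectation (Pi_pmf A d p) (\<lambda>x. f (count_label A x i)) *
      measure_pmf.expectation (Pi_pmf A d p) (\<lambda>x. g (count_label A x j))"
  using assms(1,2,4,5)
proof (induction A arbitrary: f g rule: finite_induct)
  case empty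
  then show ?case by (simp add: count_label_def)
next
  case (insert a A)
  let ?E = "measure_pmf.expectation (Pi_pmf A d p)"
  \<comment> \<open>Conditional means given that the new coordinate contributes k to the count; only
    k = 0 and k = 1 occur.\<close>
  define F where "F k = ?E (\<lambda>x. f (count_label A x i + k))" for k
  define G where "G k = ?E (\<lambda>x. g (count_label A x j + k))" for k
  have finA: "finite (set_pmf (Pi_pmf A d p))"
    using insert by (intro finite_set_Pi_pmf) auto
  have fin_a: "finite (set_pmf (p a))"
    using insert by auto
  note int [simp] = integrable_measure_pmf_finite[OF finA] integrable_measure_pmf_finite[OF fin_a]
  have F: "F 0 \<le> F 1"
    unfolding F_def using insert.prems(2) by (intro integral_mono) (auto intro: monoD)
  have G: "G 0 \<le> G 1"
    unfolding G_def using insert.prems(3) by (intro integral_mono) (auto intro: monoD)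
  have F_of_bool: "F (of_bool (y = i)) = F 0 + (F 1 - F 0) * indicat_real {i} y" for y
    by (auto simp: indicator_def)
  have G_of_bool: "G (of_bool (y = j)) = G 0 + (G 1 - G 0) * indicat_real {j} y" for y
    by (auto simp: indicator_def)
  \<comment> \<open>As i \<noteq> j, the term with both indicators vanishes.\<close>
  have FG_of_bool: "F (of_bool (y = i)) * G (of_bool (y = j)) = F 0 * G 0 +
      (F 1 - F 0) * G 0 * indicat_real {i} y + (G 1 - G 0) * F 0 * indicat_real {j} y" for y
    using ij by (auto simp: indicator_def algebra_simps)
  have "measure_pmf.expectation (Pi_pmf (insert a A) d p)
      (\<lambda>x. f (count_label (insert a A) x i) * g (count_label (insert a A) x j)) =
    measure_pmf.expectation (p a) (\<lambda>y. ?E (\<lambda>x.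
      f (count_label A x i + of_bool (y = i)) * g (count_label A x j + of_bool (y = j))))"
    using insert by (subst expectation_Pi_pmf_insert) (auto simp: count_label_insert)
  also have "\<dots> \<le> measure_pmf.expectation (p a) (\<lambda>y. F (of_bool (y = i)) * G (of_bool (y = j)))"
  proof (intro integral_mono)
    fix y
    have "mono (\<lambda>k. f (k + of_bool (y = i)))" "mono (\<lambda>k. g (k + of_bool (y = j)))"
      using insert.prems(2,3) by (auto intro!: monoI dest: monoD)
    from insert.IH[OF _ this] show
      "?E (\<lambda>x. f (count_label A x i + of_bool (y = i)) * g (count_label A x j + of_bool (y = j)))
        \<le> F (of_bool (y = i)) * G (of_bool (y = j))"
      using insert.prems(1) unfolding F_def G_def by auto
  qed auto
  also have "\<dots> = F 0 * G 0 + (F 1 - F 0) * G 0 * pmf (p a) i + (G 1 - G 0) * F 0 * pmf (p a) j"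
    unfolding FG_of_bool by (simp add: measure_pmf_single)
  \<comment> \<open>The two sides differ by
    \<open>(F 1 - F 0) * (G 1 - G 0) * pmf (p a) i * pmf (p a) j\<close>, which is
    nonnegative.\<close>
  also have "\<dots> \<le> (F 0 + (F 1 - F 0) * pmf (p a) i) * (G 0 + (G 1 - G 0) * pmf (p a) j)"
    using mult_nonneg_nonneg[OF mult_nonneg_nonneg[of "F 1 - F 0" "pmf (p a) i"]
        mult_nonneg_nonneg[of "G 1 - G 0" "pmf (p a) j"]] F G
    by (simp add: algebra_simps)
  also have "F 0 + (F 1 - F 0) * pmf (p a) i = measure_pmf.expectation (p a) (\<lambda>y. F (of_bool (y = i)))"
    unfolding F_of_bool by (simp add: measure_pmf_single)
  also have "\<dots> = measure_pmf.expectation (Pi_pmf (insert a A) d p) (\<lambda>x. f (count_label (insert a A) x i))"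
    using insert unfolding F_def
    by (subst expectation_Pi_pmf_insert) (auto simp: count_label_insert)
  also have "G 0 + (G 1 - G 0) * pmf (p a) j = measure_pmf.expectation (p a) (\<lambda>y. G (of_bool (y = j)))"
    unfolding G_of_bool by (simp add: measure_pmf_single)
  also have "\<dots> = measure_pmf.expectation (Pi_pmf (insert a A) d p) (\<lambda>x. g (count_label (insert a A) x j))"
    using insert unfolding G_def
    by (subst expectation_Pi_pmf_insert) (auto simp: count_label_insert)
  finally show ?case .
qed

section \<open>In-degrees for fixed weights\<close>

definition attach_pmf :: "(nat \<Rightarrow> real) \<Rightarrow> nat \<Rightarrow> nat pmf" where
  "attach_pmf w n = embed_pmf (\<lambda>i. if i \<in> {1..n} then w i / (\<Sum>j=1..n. w j) else 0)"

definition half_edges :: "nat \<Rightarrow> nat \<Rightarrow> (nat \<times> nat) set" where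
  "half_edges m n = {2..n} \<times> {1..m}"

text \<open>Half-edges of vertex k choose among the first k - 1 vertices, hence the shift. The
  default value 0 is not a vertex label.\<close>

definition quenched_pmf :: "(nat \<Rightarrow> real) \<Rightarrow> nat \<Rightarrow> nat \<Rightarrow> (nat \<times> nat \<Rightarrow> nat) pmf" where
  "quenched_pmf w m n = Pi_pmf (half_edges m n) 0 (\<lambda>a. attach_pmf w (fst a - 1))"

lemma finite_half_edges [simp]: "finite (half_edges m n)"
  by (simp add: half_edges_def)

lemma pmf_attach_pmf:
  assumes "\<And>i. i \<ge> 1 \<Longrightarrow> w i > 0" "n \<ge> 1"
  shows "pmf (attach_pmf w n) i = (if i \<in> {1..n} then w i / (\<Sum>j=1..n. w j) else 0)"
  unfolding attach_pmf_def
proof (rule pmf_embed_pmf)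
  have pos: "(\<Sum>j=1..n. w j) > 0"
    using assms by (intro sum_pos) auto
  then show "0 \<le> (if i \<in> {1..n} then w i / (\<Sum>j=1..n. w j) else 0)" for i
    using assms(1) by (auto intro!: divide_nonneg_pos less_imp_le)
  have "(\<integral>\<^sup>+i. ennreal (if i \<in> {1..n} then w i / (\<Sum>j=1..n. w j) else 0) \<partial>count_space UNIV) =
      (\<integral>\<^sup>+i. ennreal (if i \<in> {1..n} then w i / (\<Sum>j=1..n. w j) else 0) \<partial>count_space {1..n})"
    by (intro nn_integral_count_space_eq) auto
  also have "\<dots> = (\<Sum>i=1..n. ennreal (w i / (\<Sum>j=1..n. w j)))"
    by (subst nn_integral_count_space_finite) (auto intro!: sum.cong)
  also have "\<dots> = ennreal (\<Sum>i=1..n. w i / (\<Sum>j=1..n. w j))"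
    using pos assms(1) by (intro sum_ennreal) (auto intro!: divide_nonneg_pos less_imp_le)
  also have "(\<Sum>i=1..n. w i / (\<Sum>j=1..n. w j)) = 1"
    using pos by (simp add: sum_divide_distrib[symmetric])
  finally show "(\<integral>\<^sup>+i. ennreal (if i \<in> {1..n} then w i / (\<Sum>j=1..n. w j) else 0) \<partial>count_space UNIV) = 1"
    by simp
qed

lemma set_attach_pmf:
  assumes "\<And>i. i \<ge> 1 \<Longrightarrow> w i > 0" "n \<ge> 1"
  shows "set_pmf (attach_pmf w n) \<subseteq> {1..n}"
  using pmf_attach_pmf[OF assms] by (auto simp: set_pmf_iff split: if_splits)

text \<open>These properties hold for almost every realisation of the weights; the locale is the
  deterministic interface between the weights and the graph. The last one makes the bound w \<le> 1
  sharp up to \<delta> for a positive proportion of the labels.\<close>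

locale weight_sequence =
  fixes w :: "nat \<Rightarrow> real" and wbar :: real and m :: nat
  assumes w_pos: "i \<ge> 1 \<Longrightarrow> 0 < w i"
    and w_le_1: "i \<ge> 1 \<Longrightarrow> w i \<le> 1"
    and m_pos: "m \<ge> 1"
    and wbar_pos: "wbar > 0"
    and average: "(\<lambda>n. (\<Sum>i=1..n. w i) / real n) \<longlonglongrightarrow> wbar"
    and many_heavy: "\<delta> > 0 \<Longrightarrow>
      \<exists>c>0. \<forall>\<^sub>F n in sequentially. c * real n \<le> real (card {i \<in> {1..n}. 1 - \<delta> < w i})"
begin

definition S :: "nat \<Rightarrow> real" where "S n = (\<Sum>i=1..n. w i)"

definition \<theta> :: real where "\<theta> = 1 + wbar / real m"

definition \<mu> :: real where "\<mu> = 1 - (\<theta> - 1) / (\<theta> * ln \<theta>)"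

text \<open>With the sums S kept, \<open>m * T i n\<close> is the expected in-degree that weight 1
  would give to vertex i; it behaves like \<open>ln (n / i) / (\<theta> - 1)\<close>.\<close>

definition T :: "nat \<Rightarrow> nat \<Rightarrow> real" where "T i n = (\<Sum>k=i..<n. 1 / S k)"

abbreviation Q :: "nat \<Rightarrow> (nat \<times> nat \<Rightarrow> nat) pmf" where "Q n \<equiv> quenched_pmf w m n"

abbreviation deg :: "nat \<Rightarrow> (nat \<times> nat \<Rightarrow> nat) \<Rightarrow> nat \<Rightarrow> nat" where
  "deg n x i \<equiv> count_label (half_edges m n) x i"

definition pgf :: "real \<Rightarrow> nat \<Rightarrow> nat \<Rightarrow> real" where
  "pgf t n i = measure_pmf.expectation (Q n) (\<lambda>x. t ^ deg n x i)"

lemma \<theta>_gt_1: "\<theta> > 1"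
  using wbar_pos m_pos by (simp add: \<theta>_def)

lemma m_eq: "real m = wbar / (\<theta> - 1)"
  using wbar_pos m_pos by (simp add: \<theta>_def)

lemma \<mu>_less_1: "\<mu> < 1"
  using \<theta>_gt_1 by (simp add: \<mu>_def)

lemma \<mu>_pos: "\<mu> > 0"
proof -
  have "ln (1 / \<theta>) < 1 / \<theta> - 1"
    using \<theta>_gt_1 ln_le_minus_one[of "1 / \<theta>"] ln_eq_minus_one[of "1 / \<theta>"] by force
  then have "(\<theta> - 1) / \<theta> < ln \<theta>"
    using \<theta>_gt_1 by (simp add: ln_div field_simps)
  then show ?thesis
    using \<theta>_gt_1 by (simp add: \<mu>_def field_simps)
qed

lemma S_pos: "n \<ge> 1 \<Longrightarrow> S n > 0"
  unfolding S_def using w_pos by (intro sum_pos) auto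

lemma S_asymp: "(\<lambda>n. S n / real n) \<longlonglongrightarrow> wbar"
  unfolding S_def by (rule average)

lemma finite_set_Q: "finite (set_pmf (Q n))"
  unfolding quenched_pmf_def
proof (rule finite_set_Pi_pmf)
  fix a assume a: "a \<in> half_edges m n"
  then have "set_pmf (attach_pmf w (fst a - 1)) \<subseteq> {1..fst a - 1}"
    by (intro set_attach_pmf w_pos) (auto simp: half_edges_def)
  then show "finite (set_pmf (attach_pmf w (fst a - 1)))"
    by (rule finite_subset) simp
qed simp

lemma integrable_Q [simp]: "integrable (measure_pmf (Q n)) (f :: _ \<Rightarrow> real)"
  by (rule integrable_measure_pmf_finite[OF finite_set_Q])

section \<open>Generating functions of the in-degrees\<close>

lemma pgf_eq_prod:
  assumes "t \<ge> 0" "i \<ge> 1"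
  shows "pgf t n i = (\<Prod>k=i..<n. (1 + (t - 1) * (w i / S k)) ^ m)"
proof -
  have "pgf t n i = (\<Prod>a\<in>half_edges m n. 1 + (t - 1) * pmf (attach_pmf w (fst a - 1)) i)"
    unfolding pgf_def quenched_pmf_def using assms
    by (subst expectation_power_count_label) auto
  also have "\<dots> = (\<Prod>k=2..n. \<Prod>l=1..m. 1 + (t - 1) * pmf (attach_pmf w (k - 1)) i)"
    unfolding half_edges_def by (subst prod.cartesian_product) (simp add: case_prod_unfold)
  also have "\<dots> = (\<Prod>k=2..n. (1 + (t - 1) * pmf (attach_pmf w (k - 1)) i) ^ m)"
    by simp
  also have "\<dots> = (\<Prod>k=1..<n. (1 + (t - 1) * pmf (attach_pmf w k) i) ^ m)"
    by (rule prod.reindex_bij_witness[of _ Suc "\<lambda>k. k - 1"]) auto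
  \<comment> \<open>For k < i the vertex i is not yet present and the factor is 1.\<close>
  also have "\<dots> = (\<Prod>k=i..<n. (1 + (t - 1) * (w i / S k)) ^ m)"
    using assms by (intro prod.mono_neutral_cong_right)
      (auto simp: pmf_attach_pmf[OF w_pos] S_def)
  finally show ?thesis .
qed

lemma pgf_le:
  assumes "t \<ge> 1" "i \<ge> 1"
  shows "pgf t n i \<le> exp ((t - 1) * (real m * T i n))"
proof -
  have "pgf t n i \<le> (\<Prod>k=i..<n. exp ((t - 1) * (1 / S k)) ^ m)"
    unfolding pgf_eq_prod[OF order_trans[OF zero_le_one assms(1)] assms(2)]
  proof (intro prod_mono conjI power_mono)
    fix k assume k: "k \<in> {i..<n}"
    have nn: "0 \<le> (t - 1) * (w i / S k)"
      using k assms S_pos[of k] w_pos[of i] by auto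
    then show "0 \<le> 1 + (t - 1) * (w i / S k)" "0 \<le> (1 + (t - 1) * (w i / S k)) ^ m"
      by auto
    have "1 + (t - 1) * (w i / S k) \<le> 1 + (t - 1) * (1 / S k)"
      using k assms S_pos[of k] w_le_1[of i] by (intro add_left_mono mult_left_mono divide_right_mono) auto
    also have "\<dots> \<le> exp ((t - 1) * (1 / S k))"
      by (rule exp_ge_add_one_self)
    finally show "1 + (t - 1) * (w i / S k) \<le> exp ((t - 1) * (1 / S k))" .
  qed
  also have "\<dots> = exp ((t - 1) * (real m * T i n))"
    by (simp add: T_def exp_sum[symmetric] exp_of_nat_mult[symmetric] sum_distrib_left mult_ac)
  finally show ?thesis .
qed

text \<open>With \<open>y = (t - 1) * (w i / S k)\<close> one has
  \<open>ln (1 + y) \<ge> y - y^2 \<ge> (1 - \<delta>) * y\<close> once y \<le> \<delta>; the other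
  factor 1 - \<delta> is the lower bound for w i. As S increases, smallness of y is required at k =
  i and then holds for all later k.\<close>

lemma pgf_ge:
  assumes "t \<ge> 1" "i \<ge> 1" "0 < \<delta>" "\<delta> < 1" "1 - \<delta> < w i" "t - 1 \<le> \<delta> * S i"
  shows "exp ((t - 1) * ((1 - \<delta>)\<^sup>2 * (real m * T i n))) \<le> pgf t n i"
proof -
  have "exp ((t - 1) * ((1 - \<delta>)\<^sup>2 * (real m * T i n))) =
      (\<Prod>k=i..<n. exp ((t - 1) * (1 - \<delta>)\<^sup>2 * (1 / S k)) ^ m)"
    by (simp add: T_def exp_sum[symmetric] exp_of_nat_mult[symmetric] sum_distrib_left mult_ac)
  also have "\<dots> \<le> pgf t n i"
    unfolding pgf_eq_prod[OF order_trans[OF zero_le_one assms(1)] assms(2)]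
  proof (intro prod_mono conjI power_mono)
    fix k assume k: "k \<in> {i..<n}"
    define y where "y = (t - 1) * (w i / S k)"
    have k1: "k \<ge> 1" using k assms by auto
    have "S i \<le> S k"
      unfolding S_def using k w_pos by (intro sum_mono2) (auto intro: less_imp_le)
    then have "t - 1 \<le> \<delta> * S k"
      using assms by (meson mult_left_mono order_trans less_imp_le)
    then have "(t - 1) / S k \<le> \<delta>"
      using S_pos[OF k1] by (simp add: divide_le_eq)
    have y0: "0 \<le> y"
      using k assms S_pos[of k] w_pos[of i] by (auto simp: y_def)
    have "y = (t - 1) / S k * w i" by (simp add: y_def)
    also have "\<dots> \<le> (t - 1) / S k * 1"
      using assms S_pos[OF k1] w_le_1[of i] by (intro mult_left_mono) auto
    also have "\<dots> \<le> \<delta>" using \<open>(t - 1) / S k \<le> \<delta>\<close> by simp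
    finally have y\<delta>: "y \<le> \<delta>" .
    have "(t - 1) * (1 - \<delta>)\<^sup>2 * (1 / S k) = (1 - \<delta>) * ((t - 1) * ((1 - \<delta>) / S k))"
      by (simp add: power2_eq_square)
    also have "\<dots> \<le> (1 - \<delta>) * y"
      unfolding y_def using assms S_pos[OF k1]
      by (intro mult_left_mono divide_right_mono) auto
    also have "\<dots> \<le> y - y\<^sup>2"
      using mult_right_mono[OF y\<delta> y0] by (simp add: algebra_simps power2_eq_square)
    also have "\<dots> \<le> ln (1 + y)"
      using y0 y\<delta> assms by (intro ln_one_plus_pos_lower_bound) auto
    finally have "exp ((t - 1) * (1 - \<delta>)\<^sup>2 * (1 / S k)) \<le> exp (ln (1 + y))"
      by (simp only: exp_le_cancel_iff)
    also have "\<dots> = 1 + (t - 1) * (w i / S k)"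
      using y0 unfolding y_def by (intro exp_ln) simp
    finally show "exp ((t - 1) * (1 - \<delta>)\<^sup>2 * (1 / S k)) \<le> 1 + (t - 1) * (w i / S k)" .
  qed auto
  finally show ?thesis .
qed

text \<open>The increments d of ln telescope exactly and are asymptotic to 1 / k, so beyond some K
  the deviation of \<open>wbar / S k\<close> from \<open>d k\<close> is at most
  \<open>\<epsilon> * d k\<close>. The terms before K go into C, which is thereby independent of i
  and n.\<close>

lemma T_asymp:
  assumes "\<epsilon> > 0"
  obtains C where "\<And>i n. 1 \<le> i \<Longrightarrow> i \<le> n \<Longrightarrow> \<bar>wbar * T i n - (ln (real n) - ln (real i))\<bar> \<le> C + \<epsilon> * ln (real n)"
proof -
  define d where "d k = ln (real (Suc k)) - ln (real k)" for k
  have d_pos: "d k > 0" if "k \<ge> 1" for k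
    using that by (simp add: d_def)
  have "(\<lambda>k. real k * d k) \<longlonglongrightarrow> 1"
    unfolding d_def by real_asymp
  then have lim: "(\<lambda>k. wbar / ((S k / real k) * (real k * d k))) \<longlonglongrightarrow> wbar / (wbar * 1)"
    using wbar_pos by (intro tendsto_intros S_asymp) auto
  have "wbar / (wbar * 1) = 1"
    using wbar_pos by simp
  from tendstoD[OF lim[unfolded this] assms]
  obtain K where K: "\<And>k. k \<ge> K \<Longrightarrow> \<bar>wbar / ((S k / real k) * (real k * d k)) - 1\<bar> < \<epsilon>"
    by (auto simp: eventually_sequentially dist_real_def)
  have large: "\<bar>wbar / S k - d k\<bar> \<le> \<epsilon> * d k" if "k \<ge> K" "k \<ge> 1" for k
  proof -
    have "wbar / S k - d k = (wbar / ((S k / real k) * (real k * d k)) - 1) * d k"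
      using d_pos[OF that(2)] that(2) by (simp add: field_simps)
    then have "\<bar>wbar / S k - d k\<bar> = \<bar>wbar / ((S k / real k) * (real k * d k)) - 1\<bar> * d k"
      using d_pos[OF that(2)] by (simp add: abs_mult)
    then show ?thesis
      using K[OF that(1)] d_pos[OF that(2)] by (simp add: mult_right_mono)
  qed
  define C where "C = (\<Sum>k<K. \<bar>wbar / S k - d k\<bar>)"
  show ?thesis
  proof
    fix i n :: nat assume i: "1 \<le> i" "i \<le> n"
    have tel: "(\<Sum>k=i..<n. d k) = ln (real n) - ln (real i)"
      unfolding d_def by (rule sum_Suc_diff'[OF i(2)])
    have "wbar * T i n - (ln (real n) - ln (real i)) = (\<Sum>k=i..<n. wbar / S k - d k)"
      unfolding tel[symmetric] by (simp add: T_def sum_distrib_left sum_subtractf)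
    also have "\<bar>\<dots>\<bar> \<le> (\<Sum>k=i..<n. \<bar>wbar / S k - d k\<bar>)"
      by (rule sum_abs)
    also have "\<dots> \<le> (\<Sum>k=i..<n. (if k < K then \<bar>wbar / S k - d k\<bar> else 0) + \<epsilon> * d k)"
      using large d_pos i assms by (intro sum_mono) (auto simp: less_imp_le)
    also have "\<dots> = (\<Sum>k\<in>{i..<n} \<inter> {..<K}. \<bar>wbar / S k - d k\<bar>) + \<epsilon> * (ln (real n) - ln (real i))"
      unfolding tel[symmetric] sum.distrib sum_distrib_left
      by (subst sum.inter_restrict) auto
    also have "(\<Sum>k\<in>{i..<n} \<inter> {..<K}. \<bar>wbar / S k - d k\<bar>) \<le> C"
      unfolding C_def by (intro sum_mono2) auto
    also have "\<epsilon> * (ln (real n) - ln (real i)) \<le> \<epsilon> * ln (real n)"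
      using i assms by simp
    finally show "\<bar>wbar * T i n - (ln (real n) - ln (real i))\<bar> \<le> C + \<epsilon> * ln (real n)"
      by simp
  qed
qed

section \<open>Chernoff bounds for labels away from \<open>n^\<mu>\<close>\<close>

lemma prob_deg_ge_le:
  assumes "t \<ge> 1"
  shows "measure_pmf.prob (Q n) {x. r \<le> real (deg n x i)} \<le> exp (- r * ln t) * pgf t n i"
proof -
  have "exp (r * ln t) \<le> t ^ d" if "r \<le> real d" for d :: nat
  proof -
    have "exp (r * ln t) \<le> exp (real d * ln t)"
      using that assms by (simp add: mult_right_mono)
    then show ?thesis
      using assms by (simp add: exp_of_nat_mult)
  qed
  then have "measure_pmf.prob (Q n) {x. r \<le> real (deg n x i)} \<le>
      measure_pmf.prob (Q n) {x \<in> space (Q n). exp (r * ln t) \<le> t ^ deg n x i}"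
    by (intro measure_pmf.finite_measure_mono) auto
  also have "\<dots> \<le> measure_pmf.expectation (Q n) (\<lambda>x. t ^ deg n x i) / exp (r * ln t)"
    using assms by (intro integral_Markov_inequality_measure[where A = UNIV]) auto
  also have "\<dots> = exp (- r * ln t) * pgf t n i"
    by (simp add: pgf_def exp_minus field_simps)
  finally show ?thesis .
qed

text \<open>The expression is the exponent of n in the Chernoff bound at level
  \<open>ln n / ln \<theta>\<close> and label \<open>n^\<beta>\<close>, multiplied by the
  \<open>n^\<beta>\<close> labels of that scale. Its derivative in t at \<theta> is
  \<open>(\<mu> - \<beta>) / (\<theta> - 1)\<close>, which is where \<mu> comes from. The side of
  \<theta> on which t lies is recorded because it decides whether this exponent rises or falls with
  the scale.\<close>

lemma tilt_exponent_negative: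
  assumes "\<beta> \<noteq> \<mu>"
  obtains t where "t > 1" "\<beta> < \<mu> \<Longrightarrow> t < \<theta>" "\<mu> < \<beta> \<Longrightarrow> \<theta> < t"
    "(t - 1) / (\<theta> - 1) * (1 - \<beta>) + \<beta> - ln t / ln \<theta> < 0"
proof -
  define f where "f t = (t - 1) / (\<theta> - 1) * (1 - \<beta>) + \<beta> - ln t / ln \<theta>" for t
  have ln\<theta>: "ln \<theta> > 0"
    using \<theta>_gt_1 by simp
  have f0: "f \<theta> = 0"
    using \<theta>_gt_1 ln\<theta> by (simp add: f_def)
  have "(f has_real_derivative (1 - \<beta>) / (\<theta> - 1) - (1 / \<theta>) / ln \<theta>) (at \<theta>)"
    unfolding f_def using \<theta>_gt_1 ln\<theta> by (auto intro!: derivative_eq_intros)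
  also have "(1 - \<beta>) / (\<theta> - 1) - (1 / \<theta>) / ln \<theta> = (\<mu> - \<beta>) / (\<theta> - 1)"
    using \<theta>_gt_1 ln\<theta> by (simp add: \<mu>_def field_simps)
  finally have f': "(f has_real_derivative (\<mu> - \<beta>) / (\<theta> - 1)) (at \<theta>)" .
  show ?thesis
  proof (cases "\<beta> < \<mu>")
    case True
    then have "(\<mu> - \<beta>) / (\<theta> - 1) > 0"
      using \<theta>_gt_1 by simp
    then obtain d where d: "d > 0" "\<And>h. 0 < h \<Longrightarrow> h < d \<Longrightarrow> f (\<theta> - h) < f \<theta>"
      using DERIV_pos_inc_left[OF f'] by blast
    define h where "h = min d (\<theta> - 1) / 2"
    have "h > 0" "h < d" "h < \<theta> - 1"
      using d(1) \<theta>_gt_1 by (auto simp: h_def min_def)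
    then show ?thesis
      using True d(2)[of h] f0 by (intro that[of "\<theta> - h"]) (auto simp: f_def)
  next
    case False
    then have "\<mu> < \<beta>"
      using assms by simp
    then have "(\<mu> - \<beta>) / (\<theta> - 1) < 0"
      using \<theta>_gt_1 by (simp add: divide_neg_pos)
    then obtain d where d: "d > 0" "\<And>h. 0 < h \<Longrightarrow> h < d \<Longrightarrow> f \<theta> > f (\<theta> + h)"
      using DERIV_neg_dec_right[OF f'] by blast
    then show ?thesis
      using \<open>\<mu> < \<beta>\<close> d(2)[of "d / 2"] f0 \<theta>_gt_1
      by (intro that[of "\<theta> + d / 2"]) (auto simp: f_def)
  qed
qed

text \<open>The labels on the far side of \<open>n^\<beta>\<close> as seen from
  \<open>n^\<mu>\<close>; the case distinction lets one estimate serve both sides.\<close>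

definition region :: "real \<Rightarrow> nat \<Rightarrow> nat set" where
  "region \<beta> n = {i \<in> {1..n}. if \<beta> < \<mu> then ln (real i) \<le> \<beta> * ln (real n) else \<beta> * ln (real n) \<le> ln (real i)}"

definition level :: "real \<Rightarrow> nat \<Rightarrow> real" where
  "level \<eta> n = (1 - \<eta>) * ln (real n) / ln \<theta>"

text \<open>Each label i contributes at most a constant times \<open>n^(h/2) / i\<close> with h < 0.
  Keeping the factor 1 / i turns the union bound into a harmonic sum, which costs only a logarithm;
  at \<open>n = 2^j\<close> the result is of order \<open>j * q^j\<close>.\<close>

lemma summable_prob_high_degree_in_region:
  assumes "\<beta> \<noteq> \<mu>"
  obtains \<eta> where "\<eta> > 0"
    "summable (\<lambda>j. measure_pmf.prob (Q (2 ^ j)) {x. \<exists>i\<in>region \<beta> (2 ^ j). level \<eta> (2 ^ j) \<le> real (deg (2 ^ j) x i)})"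
proof -
  obtain t where t: "t > 1" "\<beta> < \<mu> \<Longrightarrow> t < \<theta>" "\<mu> < \<beta> \<Longrightarrow> \<theta> < t"
    "(t - 1) / (\<theta> - 1) * (1 - \<beta>) + \<beta> - ln t / ln \<theta> < 0"
    using tilt_exponent_negative[OF assms] by blast
  \<comment> \<open>The generating function at t is at most about \<open>(n / i)^\<tau>\<close>, and
    \<tau> = 1 corresponds to t = \<theta>.\<close>
  define \<tau> where "\<tau> = (t - 1) / (\<theta> - 1)"
  define h where "h = \<tau> * (1 - \<beta>) + \<beta> - ln t / ln \<theta>"
  have h: "h < 0"
    using t(4) by (simp add: h_def \<tau>_def)
  have \<tau>: "\<tau> > 0" "\<beta> < \<mu> \<Longrightarrow> \<tau> < 1" "\<mu> < \<beta> \<Longrightarrow> \<tau> > 1"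
    using t(1-3) \<theta>_gt_1 by (auto simp: \<tau>_def field_simps)
  have ln\<theta>: "ln \<theta> > 0" and lnt: "ln t > 0"
    using \<theta>_gt_1 t by simp_all
  \<comment> \<open>Lowering the level costs \<open>\<eta> * (ln t / ln \<theta>)\<close> in the
    exponent and the error of \<open>T\<close> costs \<open>\<tau> * \<eta>\<close>; together they
    use up half of the gain \<open>- h\<close>.\<close>
  define \<eta> where "\<eta> = - h / (2 * (ln t / ln \<theta> + \<tau>))"
  have den: "ln t / ln \<theta> + \<tau> > 0"
    using \<tau> ln\<theta> lnt by (intro add_pos_pos divide_pos_pos) auto
  have \<eta>: "\<eta> > 0"
    using h den by (simp add: \<eta>_def divide_neg_pos)
  have h_half: "h + \<eta> * (ln t / ln \<theta>) + \<tau> * \<eta> = h / 2"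
  proof -
    have "\<eta> * (ln t / ln \<theta> + \<tau>) = - h / 2"
      using den by (simp only: \<eta>_def times_divide_eq_left nonzero_eq_divide_eq divide_eq_eq) simp
    then show ?thesis
      by (simp add: algebra_simps)
  qed
  obtain C where C: "\<And>i n. 1 \<le> i \<Longrightarrow> i \<le> n \<Longrightarrow>
      \<bar>wbar * T i n - (ln (real n) - ln (real i))\<bar> \<le> C + \<eta> * ln (real n)"
    using T_asymp[OF \<eta>] by blast
  have single: "measure_pmf.prob (Q n) {x. level \<eta> n \<le> real (deg n x i)} \<le>
      exp (\<tau> * C + h / 2 * ln (real n)) / real i" if "i \<in> region \<beta> n" for i n
  proof -
    have i: "1 \<le> i" "i \<le> n"
      using that by (auto simp: region_def)
    \<comment> \<open>The logarithm of the bound, times i, contains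
      \<open>(1 - \<tau>) * ln i\<close>, which is controlled by its value at the edge
      \<open>n^\<beta>\<close> of the region: for \<beta> < \<mu> the factor is positive and i is
      bounded above, for \<beta> > \<mu> it is negative and i is bounded below.\<close>
    have reg: "(1 - \<tau>) * ln (real i) \<le> (1 - \<tau>) * (\<beta> * ln (real n))"
    proof (cases "\<beta> < \<mu>")
      case True
      then show ?thesis
        using that \<tau>(2) by (intro mult_left_mono) (auto simp: region_def)
    next
      case False
      then show ?thesis
        using that \<tau>(3) assms by (intro mult_left_mono_neg) (auto simp: region_def)
    qed
    have "(t - 1) * (real m * T i n) = \<tau> * (wbar * T i n)"
      by (simp add: m_eq \<tau>_def)
    also have "\<dots> \<le> \<tau> * (C + \<eta> * ln (real n) + (ln (real n) - ln (real i)))"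
      using C[OF i] \<tau>(1) by (intro mult_left_mono) auto
    finally have pgf: "(t - 1) * (real m * T i n) \<le>
      \<tau> * (C + \<eta> * ln (real n) + (ln (real n) - ln (real i)))" .
    have "measure_pmf.prob (Q n) {x. level \<eta> n \<le> real (deg n x i)} \<le>
        exp (- level \<eta> n * ln t) * pgf t n i"
      using t by (intro prob_deg_ge_le) auto
    also have "\<dots> \<le> exp (- level \<eta> n * ln t) * exp ((t - 1) * (real m * T i n))"
      using t i by (intro mult_left_mono pgf_le) auto
    also have "\<dots> = exp (- level \<eta> n * ln t + (t - 1) * (real m * T i n))"
      by (rule exp_add[symmetric])
    also have "\<dots> \<le> exp (\<tau> * C + h / 2 * ln (real n) - ln (real i))"
    proof -
      have "- level \<eta> n * ln t + (t - 1) * (real m * T i n) \<le>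
          - level \<eta> n * ln t + \<tau> * (C + \<eta> * ln (real n) + (ln (real n) - ln (real i)))"
        using pgf by simp
      also have "\<dots> = \<tau> * C + (1 - \<tau>) * ln (real i) - ln (real i) +
          (- (ln t / ln \<theta>) + \<eta> * (ln t / ln \<theta>) + \<tau> * \<eta> + \<tau>) * ln (real n)"
        by (simp add: level_def algebra_simps diff_divide_distrib add_divide_distrib)
      also have "\<dots> \<le> \<tau> * C + (1 - \<tau>) * (\<beta> * ln (real n)) - ln (real i) +
          (- (ln t / ln \<theta>) + \<eta> * (ln t / ln \<theta>) + \<tau> * \<eta> + \<tau>) * ln (real n)"
        using reg by simp
      also have "\<dots> = \<tau> * C + (h + \<eta> * (ln t / ln \<theta>) + \<tau> * \<eta>) * ln (real n) - ln (real i)"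
        by (simp add: h_def algebra_simps)
      finally show ?thesis
        unfolding h_half by (simp only: exp_le_cancel_iff)
    qed
    also have "\<dots> = exp (\<tau> * C + h / 2 * ln (real n)) / real i"
      using i by (simp add: exp_diff)
    finally show ?thesis .
  qed
  define q where "q = exp (h / 2 * ln 2)"
  have q: "0 < q" "q < 1"
    using h by (auto simp: q_def mult_neg_pos)
  have bound: "measure_pmf.prob (Q (2 ^ j)) {x. \<exists>i\<in>region \<beta> (2 ^ j). level \<eta> (2 ^ j) \<le> real (deg (2 ^ j) x i)}
      \<le> exp (\<tau> * C) * (real (Suc j) * q ^ j)" for j
  proof -
    define n :: nat where "n = 2 ^ j"
    have n: "n > 0" by (simp add: n_def)
    have ln_n: "ln (real n) = real j * ln 2"
      by (simp add: n_def ln_realpow)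
    have fin: "finite (region \<beta> n)" and sub: "region \<beta> n \<subseteq> {1..n}"
      by (auto simp: region_def)
    have "{x. \<exists>i\<in>region \<beta> n. level \<eta> n \<le> real (deg n x i)} =
        (\<Union>i\<in>region \<beta> n. {x. level \<eta> n \<le> real (deg n x i)})"
      by auto
    then have "measure_pmf.prob (Q n) {x. \<exists>i\<in>region \<beta> n. level \<eta> n \<le> real (deg n x i)} \<le>
        (\<Sum>i\<in>region \<beta> n. measure_pmf.prob (Q n) {x. level \<eta> n \<le> real (deg n x i)})"
      using fin by (simp add: measure_pmf.finite_measure_subadditive_finite)
    also have "\<dots> \<le> (\<Sum>i\<in>region \<beta> n. exp (\<tau> * C + h / 2 * ln (real n)) / real i)"
      by (intro sum_mono single)
    also have "\<dots> \<le> (\<Sum>i=1..n. exp (\<tau> * C + h / 2 * ln (real n)) / real i)"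
      using sub by (intro sum_mono2) auto
    also have "\<dots> = exp (\<tau> * C + h / 2 * ln (real n)) * harm n"
      by (simp only: harm_def sum_distrib_left divide_inverse)
    also have "\<dots> \<le> exp (\<tau> * C + h / 2 * ln (real n)) * real (Suc j)"
    proof (intro mult_left_mono)
      have "harm n \<le> ln (real n) + 1"
        using euler_mascheroni_sequence_decreasing[of 1 n] n by (simp add: harm_def)
      also have "\<dots> \<le> real (Suc j)"
        using ln_2_less_1 by (simp add: ln_n mult_left_le)
      finally show "harm n \<le> real (Suc j)" .
    qed simp
    also have "exp (\<tau> * C + h / 2 * ln (real n)) = exp (\<tau> * C) * q ^ j"
    proof -
      have "q ^ j = exp (real j * (h / 2 * ln 2))"
        unfolding q_def by (rule exp_of_nat_mult[symmetric])
      also have "real j * (h / 2 * ln 2) = h / 2 * ln (real n)"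
        by (simp add: ln_n)
      finally show ?thesis
        by (simp only: exp_add)
    qed
    finally show ?thesis
      by (simp add: n_def mult_ac)
  qed
  have "summable (\<lambda>j. real (Suc j) * q ^ j)"
    using geometric_deriv_sums[of q] q by (auto simp: sums_iff)
  then have "summable (\<lambda>j. exp (\<tau> * C) * (real (Suc j) * q ^ j))"
    by (rule summable_mult)
  then have "summable (\<lambda>j. measure_pmf.prob (Q (2 ^ j))
      {x. \<exists>i\<in>region \<beta> (2 ^ j). level \<eta> (2 ^ j) \<le> real (deg (2 ^ j) x i)})"
    by (rule summable_comparison_test') (use bound in auto)
  with \<eta> show ?thesis
    by (rule that)
qed

text \<open>The events fed to Borel-Cantelli must be fixed before the weights are; restricting
  \<eta> to reciprocals leaves a countable family to choose from.\<close>

lemma summable_prob_high_degree_in_region_reciprocal: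
  assumes "\<beta> \<noteq> \<mu>"
  obtains k where "summable (\<lambda>j. measure_pmf.prob (Q (2 ^ j))
    {x. \<exists>i\<in>region \<beta> (2 ^ j). level (1 / real (Suc k)) (2 ^ j) \<le> real (deg (2 ^ j) x i)})"
proof -
  obtain \<eta> where \<eta>: "\<eta> > 0" "summable (\<lambda>j. measure_pmf.prob (Q (2 ^ j))
      {x. \<exists>i\<in>region \<beta> (2 ^ j). level \<eta> (2 ^ j) \<le> real (deg (2 ^ j) x i)})"
    using summable_prob_high_degree_in_region[OF assms] by blast
  obtain k where k: "1 / real (Suc k) < \<eta>"
    using nat_approx_posE[OF \<eta>(1)] by blast
  have "level \<eta> (2 ^ j) \<le> level (1 / real (Suc k)) (2 ^ j)" for j
    unfolding level_def using k \<theta>_gt_1 by (intro divide_right_mono mult_right_mono) auto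
  then have "norm (measure_pmf.prob (Q (2 ^ j))
      {x. \<exists>i\<in>region \<beta> (2 ^ j). level (1 / real (Suc k)) (2 ^ j) \<le> real (deg (2 ^ j) x i)}) \<le>
    measure_pmf.prob (Q (2 ^ j)) {x. \<exists>i\<in>region \<beta> (2 ^ j). level \<eta> (2 ^ j) \<le> real (deg (2 ^ j) x i)}" for j
    by (auto intro!: measure_pmf.finite_measure_mono intro: order_trans)
  then show ?thesis
    by (intro that[of k] summable_comparison_test'[OF \<eta>(2)])
qed

section \<open>Lower bounds for the degree tail of labels near \<open>n^\<mu>\<close>\<close>

lemma power_window_bound:
  fixes d :: nat
  assumes "1 < t1" "t1 < t" "t < t2"
  shows "t ^ d \<le> indicat_real {x. a1 \<le> x} (real d) * exp (a2 * ln t) +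
    exp (- a2 * (ln t2 - ln t)) * t2 ^ d + exp (a1 * (ln t - ln t1)) * t1 ^ d"
proof -
  have pow: "s ^ d = exp (real d * ln s)" if "s > 1" for s :: real
    using that by (simp add: exp_of_nat_mult)
  have nn: "0 \<le> exp (- a2 * (ln t2 - ln t)) * t2 ^ d" "0 \<le> exp (a1 * (ln t - ln t1)) * t1 ^ d"
    "0 \<le> indicat_real {x. a1 \<le> x} (real d) * exp (a2 * ln t)"
    using assms by auto
  have ln_mono: "ln t1 < ln t" "ln t < ln t2" "0 < ln t"
    using assms by auto
  \<comment> \<open>Below a1 the ratio \<open>(t / t1)^d\<close> is at most its value at a1, and
    above a2 the ratio \<open>(t / t2)^d\<close> is at most its value at a2.\<close>
  consider "real d < a1" | "a2 < real d" | "a1 \<le> real d" "real d \<le> a2"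
    by linarith
  then show ?thesis
  proof cases
    case 1
    have "t ^ d = exp (real d * (ln t - ln t1)) * t1 ^ d"
      using assms by (simp add: pow exp_add[symmetric] algebra_simps)
    also have "\<dots> \<le> exp (a1 * (ln t - ln t1)) * t1 ^ d"
      using 1 ln_mono assms by (intro mult_right_mono) auto
    finally show ?thesis using nn by linarith
  next
    case 2
    have "t ^ d = exp (- real d * (ln t2 - ln t)) * t2 ^ d"
      using assms by (simp add: pow exp_add[symmetric] algebra_simps)
    also have "\<dots> \<le> exp (- a2 * (ln t2 - ln t)) * t2 ^ d"
      using 2 ln_mono assms by (intro mult_right_mono) auto
    finally show ?thesis using nn by linarith
  next
    case 3
    have "t ^ d \<le> exp (a2 * ln t)"
      using 3 ln_mono assms by (simp add: pow mult_right_mono)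
    also have "\<dots> = indicat_real {x. a1 \<le> x} (real d) * exp (a2 * ln t)"
      using 3 by simp
    finally show ?thesis using nn by linarith
  qed
qed

text \<open>To be read backwards: once the generating functions at t1 and t2 are bounded above and
  the one at t is bounded below, the inequality bounds the probability from below.\<close>

lemma pgf_window_bound:
  assumes "1 < t1" "t1 < t" "t < t2"
  shows "pgf t n i \<le> measure_pmf.prob (Q n) {x. a1 \<le> real (deg n x i)} * exp (a2 * ln t) +
    exp (- a2 * (ln t2 - ln t)) * pgf t2 n i + exp (a1 * (ln t - ln t1)) * pgf t1 n i"
proof -
  have "pgf t n i \<le> measure_pmf.expectation (Q n) (\<lambda>x.
      indicat_real {x. a1 \<le> real (deg n x i)} x * exp (a2 * ln t) +
      exp (- a2 * (ln t2 - ln t)) * t2 ^ deg n x i + exp (a1 * (ln t - ln t1)) * t1 ^ deg n x i)"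
    unfolding pgf_def using power_window_bound[OF assms, of "deg n _ i" a1 a2]
    by (intro integral_mono) (auto simp: indicator_def)
  then show ?thesis
    by (simp add: pgf_def)
qed

text \<open>Under the law weighted by \<open>t ^ deg\<close>, a heavy vertex with label near
  \<open>n^\<mu>\<close> has in-degree about \<open>t * \<rho> * ln n\<close>; at t = \<theta> this
  is \<open>ln n / ln \<theta>\<close>.\<close>

definition \<rho> :: real where "\<rho> = (1 - \<mu>) / (\<theta> - 1)"

lemma \<rho>_eq: "\<rho> = 1 / (\<theta> * ln \<theta>)"
  using \<theta>_gt_1 by (simp add: \<rho>_def \<mu>_def)

lemma \<rho>_pos: "\<rho> > 0"
  using \<theta>_gt_1 by (simp add: \<rho>_eq)

text \<open>There are about \<open>n^\<mu>\<close> candidate labels, and a Poisson variable of mean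
  \<open>\<rho> * ln n\<close> reaches \<open>t * \<rho> * ln n\<close> with probability roughly
  \<open>n^((t - 1) * \<rho> - t * \<rho> * ln t)\<close>. The total exponent is \<rho> times the
  increment of \<open>x * ln x - x\<close> from t to \<theta>, hence positive below
  \<theta>.\<close>

lemma tilt_exponent_positive:
  assumes "1 < t" "t < \<theta>"
  shows "\<mu> + (t - 1) * \<rho> - t * \<rho> * ln t > 0"
proof -
  have "\<mu> = 1 - (\<theta> - 1) * \<rho>"
    using \<theta>_gt_1 by (simp add: \<rho>_def)
  moreover have "\<rho> * \<theta> * ln \<theta> = 1"
    using \<theta>_gt_1 by (simp add: \<rho>_eq)
  ultimately have eq: "\<mu> + (t - 1) * \<rho> - t * \<rho> * ln t = \<rho> * (\<theta> * ln \<theta> - \<theta> + t - t * ln t)"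
    by (simp add: algebra_simps)
  have "ln (t / \<theta>) < t / \<theta> - 1"
    using assms ln_le_minus_one[of "t / \<theta>"] ln_eq_minus_one[of "t / \<theta>"] by force
  then have "\<theta> * (ln t - ln \<theta>) < t - \<theta>"
    using assms by (simp add: ln_div field_simps)
  moreover have "t * ln t < \<theta> * ln t"
    using assms by simp
  ultimately have "\<theta> * ln \<theta> - \<theta> + t - t * ln t > 0"
    by (simp add: algebra_simps)
  then show ?thesis
    unfolding eq using \<rho>_pos by simp
qed

text \<open>The expression is the exponent of the upper error term of the window relative to the
  main term. It vanishes at t2 = t, and its slope there is \<open>- \<kappa> / t\<close> because the
  window ends \<kappa> above the tilted centre \<open>t * \<rho>\<close>.\<close>

lemma upper_tilt:
  assumes "1 < t" "\<kappa> > 0"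
  obtains t2 where "t < t2" "(t2 - 1) * \<rho> - (t - 1) * \<rho> - (t * \<rho> + \<kappa>) * (ln t2 - ln t) < 0"
proof -
  define f where "f s = (s - 1) * \<rho> - (t - 1) * \<rho> - (t * \<rho> + \<kappa>) * (ln s - ln t)" for s
  have "(f has_real_derivative \<rho> - (t * \<rho> + \<kappa>) * (1 / t)) (at t)"
    unfolding f_def using assms by (auto intro!: derivative_eq_intros)
  also have "\<rho> - (t * \<rho> + \<kappa>) * (1 / t) = - \<kappa> / t"
    using assms by (simp add: field_simps)
  finally have "(f has_real_derivative - \<kappa> / t) (at t)" .
  moreover have "- \<kappa> / t < 0"
    using assms by simp
  ultimately obtain d where "d > 0" "\<And>h. 0 < h \<Longrightarrow> h < d \<Longrightarrow> f t > f (t + h)"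
    using DERIV_neg_dec_right by blast
  then have "f (t + d / 2) < f t" "t < t + d / 2" by simp_all
  then show ?thesis
    by (intro that[of "t + d / 2"]) (simp_all add: f_def)
qed

text \<open>Mirror image for the lower end of the window: the slope at t is
  \<open>\<kappa> / t\<close>, so t1 is taken below t, close enough to stay above 1.\<close>

lemma lower_tilt:
  assumes "1 < t" "\<kappa> > 0"
  obtains t1 where "1 < t1" "t1 < t" "(t1 - 1) * \<rho> - (t - 1) * \<rho> + (t * \<rho> - \<kappa>) * (ln t - ln t1) < 0"
proof -
  define f where "f s = (s - 1) * \<rho> - (t - 1) * \<rho> + (t * \<rho> - \<kappa>) * (ln t - ln s)" for s
  have "(f has_real_derivative \<rho> - (t * \<rho> - \<kappa>) * (1 / t)) (at t)"
    unfolding f_def using assms by (auto intro!: derivative_eq_intros)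
  also have "\<rho> - (t * \<rho> - \<kappa>) * (1 / t) = \<kappa> / t"
    using assms by (simp add: field_simps)
  finally have "(f has_real_derivative \<kappa> / t) (at t)" .
  moreover have "\<kappa> / t > 0"
    using assms by simp
  ultimately obtain d where d: "d > 0" "\<And>h. 0 < h \<Longrightarrow> h < d \<Longrightarrow> f (t - h) < f t"
    using DERIV_pos_inc_left by blast
  define h where "h = min d (t - 1) / 2"
  have "h > 0" "h < d" "h < t - 1"
    using d(1) assms by (auto simp: h_def min_def)
  then have "f (t - h) < f t" "1 < t - h" "t - h < t" using d(2) by simp_all
  then show ?thesis
    by (intro that[of "t - h"]) (simp_all add: f_def)
qed

lemma S_at_top: "filterlim S at_top sequentially"
proof -
  have "filterlim (\<lambda>n. (S n / real n) * real n) at_top sequentially"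
    by (rule filterlim_tendsto_pos_mult_at_top[OF S_asymp wbar_pos filterlim_real_sequentially])
  moreover have "\<forall>\<^sub>F n in sequentially. (S n / real n) * real n = S n"
    using eventually_gt_at_top[of 0] by eventually_elim simp
  ultimately show ?thesis
    using filterlim_cong[OF refl refl] by fastforce
qed

lemma ln_at_top': "\<forall>\<^sub>F n in sequentially. c \<le> ln (real n)"
proof -
  have "filterlim (\<lambda>n. ln (real n)) at_top sequentially"
    by real_asymp
  then show ?thesis
    by (simp add: filterlim_at_top)
qed

text \<open>Labels of order \<open>n\<^sup>\<mu>\<close>, for which \<open>m * T i n\<close> is asymptotic to \<open>\<rho> * ln n\<close>.\<close>

definition typical :: "real \<Rightarrow> nat \<Rightarrow> nat set" where
  "typical c n = {i \<in> {1..n}. \<mu> * ln (real n) + ln c \<le> ln (real i) \<and> ln (real i) \<le> \<mu> * ln (real n)}"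

lemma T_typical:
  assumes "\<epsilon> > 0"
  shows "\<forall>\<^sub>F n in sequentially. \<forall>i\<in>typical c n. \<bar>real m * T i n - \<rho> * ln (real n)\<bar> \<le> \<epsilon> * ln (real n)"
proof -
  \<comment> \<open>Half of the allowance covers the error of \<open>T_asymp\<close>, half the
    constants C and \<open>ln c\<close>; \<theta> - 1 is the factor in \<open>m_eq\<close>.\<close>
  define \<epsilon>' where "\<epsilon>' = \<epsilon> * (\<theta> - 1) / 2"
  have \<epsilon>': "\<epsilon>' > 0"
    using assms \<theta>_gt_1 by (simp add: \<epsilon>'_def)
  obtain C where C: "\<And>i n. 1 \<le> i \<Longrightarrow> i \<le> n \<Longrightarrow>
      \<bar>wbar * T i n - (ln (real n) - ln (real i))\<bar> \<le> C + \<epsilon>' * ln (real n)"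
    using T_asymp[OF \<epsilon>'] by blast
  have "\<forall>\<^sub>F n in sequentially. (C + \<bar>ln c\<bar>) / \<epsilon>' \<le> ln (real n)"
    by (rule ln_at_top')
  then show ?thesis
  proof eventually_elim
    case (elim n)
    then have small: "C + \<bar>ln c\<bar> \<le> \<epsilon>' * ln (real n)"
      using \<epsilon>' by (simp add: divide_le_eq mult.commute)
    show ?case
    proof
      fix i assume "i \<in> typical c n"
      then have i: "1 \<le> i" "i \<le> n" "\<mu> * ln (real n) + ln c \<le> ln (real i)" "ln (real i) \<le> \<mu> * ln (real n)"
        by (auto simp: typical_def)
      have "\<bar>wbar * T i n - (1 - \<mu>) * ln (real n)\<bar> \<le> 2 * \<epsilon>' * ln (real n)"
        using C[OF i(1,2)] small i(3,4) by (simp add: algebra_simps)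
      moreover have "real m * T i n - \<rho> * ln (real n) = (wbar * T i n - (1 - \<mu>) * ln (real n)) / (\<theta> - 1)"
        by (simp add: m_eq \<rho>_def diff_divide_distrib[of "wbar * T i n"])
      ultimately have "\<bar>real m * T i n - \<rho> * ln (real n)\<bar> \<le> 2 * \<epsilon>' * ln (real n) / (\<theta> - 1)"
        using \<theta>_gt_1 by (simp add: divide_right_mono)
      also have "\<dots> = \<epsilon> * ln (real n)"
        using \<theta>_gt_1 by (simp add: \<epsilon>'_def)
      finally show "\<bar>real m * T i n - \<rho> * ln (real n)\<bar> \<le> \<epsilon> * ln (real n)" .
    qed
  qed
qed

lemma pgf_typical_le:
  assumes "\<epsilon> > 0" "t > 1"
  shows "\<forall>\<^sub>F n in sequentially. \<forall>i\<in>typical c n. pgf t n i \<le> exp ((t - 1) * ((\<rho> + \<epsilon>) * ln (real n)))"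
  using T_typical[OF assms(1), of c]
proof eventually_elim
  case (elim n)
  show ?case
  proof
    fix i assume i: "i \<in> typical c n"
    then have "pgf t n i \<le> exp ((t - 1) * (real m * T i n))"
      using assms by (intro pgf_le) (auto simp: typical_def)
    also have "\<dots> \<le> exp ((t - 1) * ((\<rho> + \<epsilon>) * ln (real n)))"
    proof -
      have "real m * T i n \<le> (\<rho> + \<epsilon>) * ln (real n)"
        using elim i by (auto simp: distrib_right abs_le_iff)
      then show ?thesis
        using assms by simp
    qed
    finally show "pgf t n i \<le> exp ((t - 1) * ((\<rho> + \<epsilon>) * ln (real n)))" .
  qed
qed

text \<open>\<delta> is chosen before c: later c is the constant that belongs to the weights above 1
  - \<delta>.\<close>

lemma pgf_typical_ge:
  assumes "\<epsilon> > 0" "t > 1"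
  obtains \<delta> where "0 < \<delta>" "\<delta> < 1" "\<And>c. \<forall>\<^sub>F n in sequentially.
    \<forall>i\<in>typical c n. 1 - \<delta> < w i \<longrightarrow> exp ((t - 1) * ((\<rho> - \<epsilon>) * ln (real n))) \<le> pgf t n i"
proof -
  define \<epsilon>' where "\<epsilon>' = min \<rho> \<epsilon> / 2"
  have \<epsilon>': "0 < \<epsilon>'" "\<epsilon>' < \<rho>" "\<epsilon>' < \<epsilon>"
    using assms \<rho>_pos by (auto simp: \<epsilon>'_def min_def)
  have "((\<lambda>\<delta>. (1 - \<delta>)\<^sup>2 * (\<rho> - \<epsilon>')) \<longlongrightarrow> (1 - 0)\<^sup>2 * (\<rho> - \<epsilon>')) (at_right (0::real))"
    by (intro tendsto_intros)
  moreover have "\<rho> - \<epsilon> < (1 - 0)\<^sup>2 * (\<rho> - \<epsilon>')"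
    using \<epsilon>' by simp
  ultimately have "\<forall>\<^sub>F \<delta> in at_right 0. \<rho> - \<epsilon> < (1 - \<delta>)\<^sup>2 * (\<rho> - \<epsilon>')"
    by (rule order_tendstoD)
  moreover have "\<forall>\<^sub>F \<delta> in at_right (0::real). \<delta> \<in> {0<..<1}"
    by (rule eventually_at_right_real) simp
  ultimately have "\<forall>\<^sub>F \<delta> in at_right (0::real). \<delta> \<in> {0<..<1} \<and> \<rho> - \<epsilon> < (1 - \<delta>)\<^sup>2 * (\<rho> - \<epsilon>')"
    by eventually_elim simp
  then obtain \<delta> where \<delta>: "0 < \<delta>" "\<delta> < 1" "\<rho> - \<epsilon> < (1 - \<delta>)\<^sup>2 * (\<rho> - \<epsilon>')"
    using eventually_happens[of _ "at_right (0::real)"] by (auto simp: trivial_limit_at_right_real)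
  show ?thesis
  proof (rule that[OF \<delta>(1,2)])
    fix c :: real
    have "\<forall>\<^sub>F k in sequentially. (t - 1) / \<delta> \<le> S k"
      using S_at_top by (simp add: filterlim_at_top)
    then obtain K where K: "\<And>k. k \<ge> K \<Longrightarrow> (t - 1) / \<delta> \<le> S k"
      by (auto simp: eventually_sequentially)
    \<comment> \<open>Typical labels tend to infinity with n, so eventually they reach K and the
      smallness condition of \<open>pgf_ge\<close> holds.\<close>
    have "\<forall>\<^sub>F n in sequentially. (ln (real (K + 1)) - ln c) / \<mu> \<le> ln (real n)"
      by (rule ln_at_top')
    then show "\<forall>\<^sub>F n in sequentially.
      \<forall>i\<in>typical c n. 1 - \<delta> < w i \<longrightarrow> exp ((t - 1) * ((\<rho> - \<epsilon>) * ln (real n))) \<le> pgf t n i"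
      using T_typical[OF \<epsilon>'(1), of c] eventually_ge_at_top[of 1]
    proof eventually_elim
      case (elim n)
      show ?case
      proof (intro ballI impI)
        fix i assume i: "i \<in> typical c n" and heavy: "1 - \<delta> < w i"
        then have i1: "i \<ge> 1"
          by (simp add: typical_def)
        have "ln (real (K + 1)) \<le> \<mu> * ln (real n) + ln c"
          using elim(1) \<mu>_pos by (simp add: divide_le_eq algebra_simps)
        also have "\<dots> \<le> ln (real i)"
          using i by (simp add: typical_def)
        finally have "i \<ge> K"
          using i1 by (simp add: ln_le_cancel_iff)
        from K[OF this] have tS: "t - 1 \<le> \<delta> * S i"
          using \<delta> by (simp add: divide_le_eq mult.commute)
        have "(\<rho> - \<epsilon>) * ln (real n) \<le> ((1 - \<delta>)\<^sup>2 * (\<rho> - \<epsilon>')) * ln (real n)"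
          using \<delta>(3) elim(3) by (intro mult_right_mono) auto
        also have "\<dots> = (1 - \<delta>)\<^sup>2 * ((\<rho> - \<epsilon>') * ln (real n))"
          by simp
        also have "\<dots> \<le> (1 - \<delta>)\<^sup>2 * (real m * T i n)"
          using elim(2) i by (intro mult_left_mono) (auto simp: algebra_simps abs_le_iff)
        finally have "exp ((t - 1) * ((\<rho> - \<epsilon>) * ln (real n))) \<le> exp ((t - 1) * ((1 - \<delta>)\<^sup>2 * (real m * T i n)))"
          using assms by simp
        also have "\<dots> \<le> pgf t n i"
          using \<delta> heavy tS i1 assms by (intro pgf_ge) auto
        finally show "exp ((t - 1) * ((\<rho> - \<epsilon>) * ln (real n))) \<le> pgf t n i" .
      qed
    qed
  qed
qed

text \<open>The window consists of the degrees within \<open>\<kappa> * ln n\<close> of the tilted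
  centre \<open>t * \<rho> * ln n\<close>. Undoing the tilt costs the value of \<open>t^d\<close> at
  the upper end of the window, so the exponent is that of \<open>tilt_exponent_positive\<close>
  minus \<mu>, up to small losses; half of the gain g is kept as \<gamma>.\<close>

lemma prob_typical_high_degree_ge:
  assumes "0 < \<eta>" "\<eta> < 1"
  obtains \<gamma> \<delta> where "\<gamma> > 0" "0 < \<delta>" "\<delta> < 1" "\<And>c. \<forall>\<^sub>F n in sequentially.
    \<forall>i\<in>typical c n. 1 - \<delta> < w i \<longrightarrow>
      exp ((\<gamma> - \<mu>) * ln (real n)) / 2 \<le> measure_pmf.prob (Q n) {x. level \<eta> n \<le> real (deg n x i)}"
proof -
  have ln\<theta>: "ln \<theta> > 0"
    using \<theta>_gt_1 by simp
  \<comment> \<open>The bound \<open>(1 - \<eta>) * \<theta> < t\<close> places the centre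
    \<open>t * \<rho> * ln n\<close> above \<open>level \<eta> n\<close>.\<close>
  have "max 1 ((1 - \<eta>) * \<theta>) < \<theta>"
    using assms \<theta>_gt_1 by simp
  then obtain t where "max 1 ((1 - \<eta>) * \<theta>) < t" "t < \<theta>"
    using dense by blast
  then have t: "1 < t" "(1 - \<eta>) * \<theta> < t" "t < \<theta>"
    by simp_all
  have lnt: "ln t > 0"
    using t by simp
  define g where "g = \<mu> + (t - 1) * \<rho> - t * \<rho> * ln t"
  have g: "g > 0"
    using tilt_exponent_positive[OF t(1,3)] by (simp add: g_def)
  have gap: "t * \<rho> - (1 - \<eta>) / ln \<theta> > 0"
  proof -
    have "(1 - \<eta>) / ln \<theta> = (1 - \<eta>) * \<theta> * \<rho>"
      using \<theta>_gt_1 by (simp add: \<rho>_eq)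
    also have "\<dots> < t * \<rho>"
      using t \<rho>_pos by (intro mult_strict_right_mono) auto
    finally show ?thesis by simp
  qed
  \<comment> \<open>The first bound keeps the lower end of the window above the level, the second
    limits the cost \<open>\<kappa> * ln t\<close> of its upper end to g / 4.\<close>
  define \<kappa> where "\<kappa> = min (t * \<rho> - (1 - \<eta>) / ln \<theta>) (g / (4 * ln t))"
  have \<kappa>: "\<kappa> > 0" "(1 - \<eta>) / ln \<theta> \<le> t * \<rho> - \<kappa>" "\<kappa> * ln t \<le> g / 4"
  proof -
    show "\<kappa> > 0"
      using gap g lnt by (simp add: \<kappa>_def)
    show "(1 - \<eta>) / ln \<theta> \<le> t * \<rho> - \<kappa>"
      by (simp add: \<kappa>_def)
    have "\<kappa> * ln t \<le> g / (4 * ln t) * ln t"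
      using lnt by (intro mult_right_mono) (auto simp: \<kappa>_def)
    then show "\<kappa> * ln t \<le> g / 4"
      using lnt by simp
  qed
  obtain t2 where t2: "t < t2" "(t2 - 1) * \<rho> - (t - 1) * \<rho> - (t * \<rho> + \<kappa>) * (ln t2 - ln t) < 0"
    using upper_tilt[OF t(1) \<kappa>(1)] by blast
  obtain t1 where t1: "1 < t1" "t1 < t" "(t1 - 1) * \<rho> - (t - 1) * \<rho> + (t * \<rho> - \<kappa>) * (ln t - ln t1) < 0"
    using lower_tilt[OF t(1) \<kappa>(1)] by blast
  \<comment> \<open>A common margin for both error exponents, capped at g / 2 so that losses
    measured in u stay small against the gain g.\<close>
  define u where "u = min (g / 2) (min (- ((t2 - 1) * \<rho> - (t - 1) * \<rho> - (t * \<rho> + \<kappa>) * (ln t2 - ln t)))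
    (- ((t1 - 1) * \<rho> - (t - 1) * \<rho> + (t * \<rho> - \<kappa>) * (ln t - ln t1))))"
  have u: "u > 0" "u \<le> g / 2"
    "(t2 - 1) * \<rho> - (t - 1) * \<rho> - (t * \<rho> + \<kappa>) * (ln t2 - ln t) \<le> - u"
    "(t1 - 1) * \<rho> - (t - 1) * \<rho> + (t * \<rho> - \<kappa>) * (ln t - ln t1) \<le> - u"
    using g t1 t2 by (auto simp: u_def min_def)
  \<comment> \<open>The approximation errors at t, t1 and t2 are then at most u / 4 each. Two of
    them enter each comparison, which leaves u / 2 of the margin to beat the factor 4.\<close>
  define \<epsilon> where "\<epsilon> = u / (4 * (t2 - 1))"
  have \<epsilon>: "\<epsilon> > 0" "(t2 - 1) * \<epsilon> = u / 4"
    using u(1) t t2 by (simp_all add: \<epsilon>_def divide_simps)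
  have \<epsilon>_t: "(t - 1) * \<epsilon> \<le> u / 4" "(t1 - 1) * \<epsilon> \<le> u / 4"
    unfolding \<epsilon>(2)[symmetric] using \<epsilon>(1) t2 t1 by (intro mult_right_mono; simp)+
  obtain \<delta> where \<delta>: "0 < \<delta>" "\<delta> < 1" and pgf_ge: "\<And>c. \<forall>\<^sub>F n in sequentially.
    \<forall>i\<in>typical c n. 1 - \<delta> < w i \<longrightarrow> exp ((t - 1) * ((\<rho> - \<epsilon>) * ln (real n))) \<le> pgf t n i"
    using pgf_typical_ge[OF \<epsilon>(1) t(1)] by blast
  show ?thesis
  proof (rule that[of "g / 2" \<delta>])
    fix c
    have "1 < t2" using t t2 by simp
    from pgf_typical_le[OF \<epsilon>(1) this, of c] pgf_typical_le[OF \<epsilon>(1) t1(1), of c] pgf_ge[of c]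
      ln_at_top'[of "2 * ln 4 / u"]
    show "\<forall>\<^sub>F n in sequentially. \<forall>i\<in>typical c n. 1 - \<delta> < w i \<longrightarrow>
      exp ((g / 2 - \<mu>) * ln (real n)) / 2 \<le> measure_pmf.prob (Q n) {x. level \<eta> n \<le> real (deg n x i)}"
    proof eventually_elim
      case (elim n)
      show ?case
      proof (intro ballI impI)
        fix i assume i: "i \<in> typical c n" and heavy: "1 - \<delta> < w i"
        define l where "l = ln (real n)"
        have l: "u / 2 * l \<ge> ln 4"
          using elim(4) u(1) by (simp add: l_def divide_le_eq mult_ac)
        have l0: "l \<ge> 0"
          using i by (simp add: l_def typical_def)
        define E where "E = exp ((t - 1) * ((\<rho> - \<epsilon>) * l))"
        have E: "E \<le> pgf t n i" "E > 0"
          using elim(3) i heavy by (auto simp: E_def l_def)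
        have quarter: "exp y \<le> E / 4" if "y \<le> (t - 1) * ((\<rho> - \<epsilon>) * l) - u / 2 * l" for y
        proof -
          have "exp y \<le> exp ((t - 1) * ((\<rho> - \<epsilon>) * l) - ln 4)"
            using that l by simp
          then show ?thesis by (simp add: E_def exp_diff)
        qed
        have "exp (- ((t * \<rho> + \<kappa>) * l) * (ln t2 - ln t)) * pgf t2 n i \<le>
            exp (- ((t * \<rho> + \<kappa>) * l) * (ln t2 - ln t)) * exp ((t2 - 1) * ((\<rho> + \<epsilon>) * l))"
          using elim(1) i by (intro mult_left_mono) (auto simp: l_def)
        also have "\<dots> = exp (- ((t * \<rho> + \<kappa>) * l) * (ln t2 - ln t) + (t2 - 1) * ((\<rho> + \<epsilon>) * l))"
          by (rule exp_add[symmetric])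
        also have "\<dots> \<le> E / 4"
        proof (rule quarter)
          have "((t2 - 1) * \<rho> - (t * \<rho> + \<kappa>) * (ln t2 - ln t) + (t2 - 1) * \<epsilon>) * l \<le>
              ((t - 1) * \<rho> - (t - 1) * \<epsilon> - u / 2) * l"
            using u(3) \<epsilon>(2) \<epsilon>_t l0 by (intro mult_right_mono) auto
          then show "- ((t * \<rho> + \<kappa>) * l) * (ln t2 - ln t) + (t2 - 1) * ((\<rho> + \<epsilon>) * l) \<le>
              (t - 1) * ((\<rho> - \<epsilon>) * l) - u / 2 * l"
            by (simp add: algebra_simps)
        qed
        finally have B2: "exp (- ((t * \<rho> + \<kappa>) * l) * (ln t2 - ln t)) * pgf t2 n i \<le> E / 4" .
        have "exp ((t * \<rho> - \<kappa>) * l * (ln t - ln t1)) * pgf t1 n i \<le>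
            exp ((t * \<rho> - \<kappa>) * l * (ln t - ln t1)) * exp ((t1 - 1) * ((\<rho> + \<epsilon>) * l))"
          using elim(2) i by (intro mult_left_mono) (auto simp: l_def)
        also have "\<dots> = exp ((t * \<rho> - \<kappa>) * l * (ln t - ln t1) + (t1 - 1) * ((\<rho> + \<epsilon>) * l))"
          by (rule exp_add[symmetric])
        also have "\<dots> \<le> E / 4"
        proof (rule quarter)
          have "((t1 - 1) * \<rho> + (t * \<rho> - \<kappa>) * (ln t - ln t1) + (t1 - 1) * \<epsilon>) * l \<le>
              ((t - 1) * \<rho> - (t - 1) * \<epsilon> - u / 2) * l"
            using u(4) \<epsilon>_t l0 by (intro mult_right_mono) auto
          then show "(t * \<rho> - \<kappa>) * l * (ln t - ln t1) + (t1 - 1) * ((\<rho> + \<epsilon>) * l) \<le>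
              (t - 1) * ((\<rho> - \<epsilon>) * l) - u / 2 * l"
            by (simp add: algebra_simps)
        qed
        finally have B1: "exp ((t * \<rho> - \<kappa>) * l * (ln t - ln t1)) * pgf t1 n i \<le> E / 4" .
        have "E / 2 \<le> measure_pmf.prob (Q n) {x. (t * \<rho> - \<kappa>) * l \<le> real (deg n x i)} *
            exp ((t * \<rho> + \<kappa>) * l * ln t)"
          using pgf_window_bound[OF t1(1,2) t2(1), of n i "(t * \<rho> - \<kappa>) * l" "(t * \<rho> + \<kappa>) * l"] B1 B2 E
          by linarith
        moreover have "E * exp (- y) / 2 \<le> p" if "E / 2 \<le> p * exp y" for y p :: real
          using that by (simp add: exp_minus field_simps)
        ultimately have "E * exp (- ((t * \<rho> + \<kappa>) * l * ln t)) / 2 \<le>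
            measure_pmf.prob (Q n) {x. (t * \<rho> - \<kappa>) * l \<le> real (deg n x i)}"
          by blast
        also have "\<dots> \<le> measure_pmf.prob (Q n) {x. level \<eta> n \<le> real (deg n x i)}"
        proof (intro measure_pmf.finite_measure_mono subsetI CollectI)
          fix x assume x: "x \<in> {x. (t * \<rho> - \<kappa>) * l \<le> real (deg n x i)}"
          have "level \<eta> n = (1 - \<eta>) / ln \<theta> * l"
            by (simp add: level_def l_def)
          also have "\<dots> \<le> (t * \<rho> - \<kappa>) * l"
            using \<kappa>(2) l0 by (rule mult_right_mono)
          finally show "level \<eta> n \<le> real (deg n x i)"
            using x by simp
        qed simp
        also have "E * exp (- ((t * \<rho> + \<kappa>) * l * ln t)) = exp ((t - 1) * ((\<rho> - \<epsilon>) * l) - (t * \<rho> + \<kappa>) * l * ln t)"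
          by (simp add: E_def exp_add[symmetric])
        finally have "exp ((t - 1) * ((\<rho> - \<epsilon>) * l) - (t * \<rho> + \<kappa>) * l * ln t) / 2 \<le>
          measure_pmf.prob (Q n) {x. level \<eta> n \<le> real (deg n x i)}" .
        moreover have "(g / 2 - \<mu>) * l \<le> (t - 1) * ((\<rho> - \<epsilon>) * l) - (t * \<rho> + \<kappa>) * l * ln t"
        proof -
          \<comment> \<open>The losses are at most u / 4, hence g / 8, from the generating function
            and g / 4 from the width of the window.\<close>
          have "g / 2 - \<mu> \<le> g - \<mu> - (t - 1) * \<epsilon> - \<kappa> * ln t"
            using \<epsilon>_t(1) u(2) \<kappa>(3) g by linarith
          also have "\<dots> = (t - 1) * \<rho> - (t - 1) * \<epsilon> - t * \<rho> * ln t - \<kappa> * ln t"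
            by (simp add: g_def)
          finally have "g / 2 - \<mu> \<le> (t - 1) * \<rho> - (t - 1) * \<epsilon> - t * \<rho> * ln t - \<kappa> * ln t" .
          then have "(g / 2 - \<mu>) * l \<le> ((t - 1) * \<rho> - (t - 1) * \<epsilon> - t * \<rho> * ln t - \<kappa> * ln t) * l"
            using l0 by (rule mult_right_mono)
          then show ?thesis by (simp add: algebra_simps)
        qed
        ultimately show "exp ((g / 2 - \<mu>) * ln (real n)) / 2 \<le>
            measure_pmf.prob (Q n) {x. level \<eta> n \<le> real (deg n x i)}"
          unfolding l_def[symmetric] by (meson divide_right_mono exp_le_cancel_iff order_trans zero_le_numeral)
      qed
    qed
  qed (use g \<delta> in auto)
qed

section \<open>Second moments and the existence of a high degree\<close>

lemma Q_negative_correlation: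
  fixes f g :: "nat \<Rightarrow> real"
  assumes "i \<noteq> j" "mono f" "mono g"
  shows "measure_pmf.expectation (Q n) (\<lambda>x. f (deg n x i) * g (deg n x j)) \<le>
    measure_pmf.expectation (Q n) (\<lambda>x. f (deg n x i)) * measure_pmf.expectation (Q n) (\<lambda>x. g (deg n x j))"
  unfolding quenched_pmf_def
proof (rule count_label_negative_correlation)
  fix a assume "a \<in> half_edges m n"
  then have "set_pmf (attach_pmf w (fst a - 1)) \<subseteq> {1..fst a - 1}"
    by (intro set_attach_pmf w_pos) (auto simp: half_edges_def)
  then show "finite (set_pmf (attach_pmf w (fst a - 1)))"
    by (rule finite_subset) simp
qed (simp_all add: assms)

text \<open>The indicator of a high degree is monotone in the degree, so distinct vertices have
  nonpositive covariance and the variance of the count is at most its mean e. A count of zero is a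
  deviation by e, of probability at most \<open>e / e^2\<close>.\<close>

lemma prob_all_degrees_low_le:
  assumes "finite G" and "0 < s"
    and "s \<le> (\<Sum>i\<in>G. measure_pmf.prob (Q n) {x. r \<le> real (deg n x i)})"
  shows "measure_pmf.prob (Q n) {x. \<forall>i\<in>G. real (deg n x i) < r} \<le> 1 / s"
proof -
  let ?E = "measure_pmf.expectation (Q n)"
  define f where "f d = (if r \<le> real d then 1 else 0 :: real)" for d :: nat
  have mono_f: "mono f"
    by (rule monoI) (auto simp: f_def)
  have Ef: "?E (\<lambda>x. f (deg n x i)) = measure_pmf.prob (Q n) {x. r \<le> real (deg n x i)}" for i
  proof -
    have "?E (\<lambda>x. f (deg n x i)) = ?E (indicat_real {x. r \<le> real (deg n x i)})"
      by (intro Bochner_Integration.integral_cong) (auto simp: f_def indicator_def)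
    then show ?thesis by simp
  qed
  define N where "N x = (\<Sum>i\<in>G. f (deg n x i))" for x
  define e where "e = ?E N"
  have e: "e = (\<Sum>i\<in>G. measure_pmf.prob (Q n) {x. r \<le> real (deg n x i)})"
    unfolding e_def N_def by (simp add: Ef)
  have e_pos: "e > 0" and s_le: "s \<le> e"
    using assms e by auto
  have "?E (\<lambda>x. (N x)\<^sup>2) = (\<Sum>i\<in>G. \<Sum>j\<in>G. ?E (\<lambda>x. f (deg n x i) * f (deg n x j)))"
    by (simp add: N_def power2_eq_square sum_product)
  also have "\<dots> \<le> (\<Sum>i\<in>G. \<Sum>j\<in>G. (if i = j then ?E (\<lambda>x. f (deg n x i)) else 0) +
      ?E (\<lambda>x. f (deg n x i)) * ?E (\<lambda>x. f (deg n x j)))"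
  proof (intro sum_mono)
    fix i j
    show "?E (\<lambda>x. f (deg n x i) * f (deg n x j)) \<le> (if i = j then ?E (\<lambda>x. f (deg n x i)) else 0) +
      ?E (\<lambda>x. f (deg n x i)) * ?E (\<lambda>x. f (deg n x j))"
    proof (cases "i = j")
      case True
      have "f d * f d = f d" for d
        by (simp add: f_def)
      then have "?E (\<lambda>x. f (deg n x j) * f (deg n x j)) = ?E (\<lambda>x. f (deg n x j))"
        by presburger
      then show ?thesis
        using True by simp
    next
      case False
      then show ?thesis
        using Q_negative_correlation[OF False mono_f mono_f] by simp
    qed
  qed
  also have "\<dots> = e + e\<^sup>2"
    using assms(1) by (simp add: sum.distrib Ef e power2_eq_square sum_product)
  finally have second: "?E (\<lambda>x. (N x)\<^sup>2) \<le> e + e\<^sup>2" .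
  have "measure_pmf.variance (Q n) N \<le> e"
    using second by (subst measure_pmf.variance_eq) (auto simp: e_def)
  have "measure_pmf.prob (Q n) {x. \<forall>i\<in>G. real (deg n x i) < r} \<le>
      measure_pmf.prob (Q n) {x \<in> space (Q n). \<bar>N x - ?E N\<bar> \<ge> e}"
  proof (intro measure_pmf.finite_measure_mono subsetI)
    fix x assume "x \<in> {x. \<forall>i\<in>G. real (deg n x i) < r}"
    then have "N x = 0"
      by (auto simp: N_def f_def intro!: sum.neutral)
    then show "x \<in> {x \<in> space (Q n). \<bar>N x - ?E N\<bar> \<ge> e}"
      by (simp add: e_def)
  qed simp
  also have "\<dots> \<le> measure_pmf.variance (Q n) N / e\<^sup>2"
    using e_pos by (intro measure_pmf.Chebyshev_inequality) auto
  also have "\<dots> \<le> e / e\<^sup>2"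
    using \<open>measure_pmf.variance (Q n) N \<le> e\<close> by (rule divide_right_mono) simp
  also have "\<dots> \<le> 1 / s"
    using e_pos s_le assms(2) by (simp add: power2_eq_square frac_le)
  finally show ?thesis .
qed

text \<open>At least a proportion c of the labels up to L, the integer part of
  \<open>n^\<mu>\<close>, is heavy. Rounding loses at most half, and discarding the first
  \<open>c / 4 * n^\<mu>\<close> labels, which are too small to be typical, removes half of the
  rest; so c / 4 is both the cutoff and the remaining proportion.\<close>

lemma card_heavy_typical:
  assumes "\<delta> > 0"
  obtains c where "c > 0" "\<forall>\<^sub>F n in sequentially.
    c * exp (\<mu> * ln (real n)) \<le> real (card {i \<in> typical c n. 1 - \<delta> < w i})"
proof -
  obtain c where c: "c > 0" "\<forall>\<^sub>F n in sequentially. c * real n \<le> real (card {i \<in> {1..n}. 1 - \<delta> < w i})"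
    using many_heavy[OF assms] by blast
  define L where "L n = nat \<lfloor>exp (\<mu> * ln (real n))\<rfloor>" for n :: nat
  have L_lim: "filterlim L at_top sequentially"
    unfolding L_def using \<mu>_pos by real_asymp
  have c_L: "\<forall>\<^sub>F n in sequentially. c * real (L n) \<le> real (card {i \<in> {1..L n}. 1 - \<delta> < w i})"
    using c(2) L_lim by (rule eventually_compose_filterlim)
  show ?thesis
  proof (rule that[of "c / 4"])
    show "c / 4 > 0" using c by simp
    show "\<forall>\<^sub>F n in sequentially.
      c / 4 * exp (\<mu> * ln (real n)) \<le> real (card {i \<in> typical (c / 4) n. 1 - \<delta> < w i})"
      using c_L eventually_ge_at_top[of 1]
    proof eventually_elim
      case (elim n)
      define y where "y = exp (\<mu> * ln (real n))"
      have y1: "y \<ge> 1"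
        using \<mu>_pos elim by (simp add: y_def)
      have y_n: "y \<le> real n"
      proof -
        have "\<mu> * ln (real n) \<le> 1 * ln (real n)"
          using \<mu>_less_1 elim by (intro mult_right_mono) auto
        then have "y \<le> exp (ln (real n))"
          by (simp add: y_def)
        then show ?thesis using elim by simp
      qed
      have L: "real (L n) \<le> y" "y / 2 \<le> real (L n)"
      proof -
        have "real (L n) = of_int \<lfloor>y\<rfloor>"
          using y1 by (simp add: L_def y_def[symmetric])
        moreover have "1 \<le> \<lfloor>y\<rfloor>"
          using y1 by simp
        ultimately show "real (L n) \<le> y" "y / 2 \<le> real (L n)"
          by linarith+
      qed
      define z where "z = nat \<lfloor>c * y / 4\<rfloor>"
      have z: "real z \<le> c * y / 4"
      proof -
        have "real z = of_int \<lfloor>c * y / 4\<rfloor>"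
          using c y1 by (simp add: z_def)
        then show ?thesis by linarith
      qed
      let ?H = "{i \<in> {1..L n}. 1 - \<delta> < w i}"
      have "?H - {1..z} \<subseteq> {i \<in> typical (c / 4) n. 1 - \<delta> < w i}"
      proof
        fix i assume i: "i \<in> ?H - {1..z}"
        then have iy: "1 \<le> i" "real i \<le> y"
          using L by auto
        have "c * y / 4 < real i"
          using i c y1 unfolding z_def by simp linarith
        then have "ln (c / 4 * y) \<le> ln (real i)"
          using c y1 iy by (subst ln_le_cancel_iff) auto
        moreover have "ln (c / 4 * y) = \<mu> * ln (real n) + ln (c / 4)"
          using c by (subst ln_mult) (auto simp: y_def)
        moreover have "ln (real i) \<le> \<mu> * ln (real n)"
          using iy ln_le_cancel_iff[of "real i" y] by (simp add: y_def)
        moreover have "i \<le> n"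
          using iy y_n by linarith
        ultimately show "i \<in> {i \<in> typical (c / 4) n. 1 - \<delta> < w i}"
          using i iy by (simp add: typical_def)
      qed
      then have "card (?H - {1..z}) \<le> card {i \<in> typical (c / 4) n. 1 - \<delta> < w i}"
        by (intro card_mono) (auto simp: typical_def)
      moreover have "card ?H - z \<le> card (?H - {1..z})"
        using diff_card_le_card_Diff[of "{1..z}" ?H] by simp
      ultimately have "real (card ?H) - real z \<le> real (card {i \<in> typical (c / 4) n. 1 - \<delta> < w i})"
        by linarith
      moreover have "c * (y / 2) \<le> c * real (L n)"
        using L(2) c by (intro mult_left_mono) auto
      ultimately show ?case
        using elim(1) z unfolding y_def[symmetric] by simp
    qed
  qed
qed

text \<open>The expected number of high degrees is at least of order
  \<open>n^\<mu> * n^(\<gamma> - \<mu>)\<close>, so the second moment bound decays like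
  \<open>n^(-\<gamma>)\<close>. As \<gamma> may be small, summability is obtained along powers of
  two.\<close>

lemma summable_prob_all_degrees_low:
  assumes "0 < \<eta>" "\<eta> < 1"
  shows "summable (\<lambda>j. measure_pmf.prob (Q (2 ^ j)) {x. \<forall>i\<in>{1..2 ^ j}. real (deg (2 ^ j) x i) < level \<eta> (2 ^ j)})"
proof -
  obtain \<gamma> \<delta> where \<gamma>: "\<gamma> > 0" and \<delta>: "0 < \<delta>" "\<delta> < 1" and prob_ge: "\<And>c. \<forall>\<^sub>F n in sequentially.
    \<forall>i\<in>typical c n. 1 - \<delta> < w i \<longrightarrow>
      exp ((\<gamma> - \<mu>) * ln (real n)) / 2 \<le> measure_pmf.prob (Q n) {x. level \<eta> n \<le> real (deg n x i)}"
    using prob_typical_high_degree_ge[OF assms] by blast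
  obtain c where c: "c > 0" "\<forall>\<^sub>F n in sequentially.
    c * exp (\<mu> * ln (real n)) \<le> real (card {i \<in> typical c n. 1 - \<delta> < w i})"
    using card_heavy_typical[OF \<delta>(1)] by blast
  have bound: "\<forall>\<^sub>F n in sequentially.
    measure_pmf.prob (Q n) {x. \<forall>i\<in>{1..n}. real (deg n x i) < level \<eta> n} \<le> 2 / c * exp (- \<gamma> * ln (real n))"
    using c(2) prob_ge[of c]
  proof eventually_elim
    case (elim n)
    define G where "G = {i \<in> typical c n. 1 - \<delta> < w i}"
    have G: "finite G" "G \<subseteq> {1..n}"
      by (auto simp: G_def typical_def)
    define s where "s = c / 2 * exp (\<gamma> * ln (real n))"
    have "s = c * exp (\<mu> * ln (real n)) * (exp ((\<gamma> - \<mu>) * ln (real n)) / 2)"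
      by (simp add: s_def exp_add[symmetric] algebra_simps)
    also have "\<dots> \<le> real (card G) * (exp ((\<gamma> - \<mu>) * ln (real n)) / 2)"
      using elim(1) unfolding G_def by (rule mult_right_mono) simp
    also have "\<dots> \<le> (\<Sum>i\<in>G. measure_pmf.prob (Q n) {x. level \<eta> n \<le> real (deg n x i)})"
      using elim(2) by (intro sum_bounded_below) (auto simp: G_def)
    finally have s: "s \<le> (\<Sum>i\<in>G. measure_pmf.prob (Q n) {x. level \<eta> n \<le> real (deg n x i)})" .
    have "measure_pmf.prob (Q n) {x. \<forall>i\<in>{1..n}. real (deg n x i) < level \<eta> n} \<le>
        measure_pmf.prob (Q n) {x. \<forall>i\<in>G. real (deg n x i) < level \<eta> n}"
      using G by (intro measure_pmf.finite_measure_mono) auto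
    also have "\<dots> \<le> 1 / s"
      using G s c(1) by (intro prob_all_degrees_low_le) (auto simp: s_def)
    also have "\<dots> = 2 / c * exp (- \<gamma> * ln (real n))"
      by (simp add: s_def exp_minus field_simps)
    finally show ?case .
  qed
  define q where "q = exp (- \<gamma> * ln 2)"
  have q: "0 < q" "q < 1"
    using \<gamma> by (auto simp: q_def)
  have "filterlim (\<lambda>j. 2 ^ j :: nat) at_top sequentially"
    by real_asymp
  from eventually_compose_filterlim[OF bound this]
  have "\<forall>\<^sub>F j in sequentially. norm (measure_pmf.prob (Q (2 ^ j))
      {x. \<forall>i\<in>{1..2 ^ j}. real (deg (2 ^ j) x i) < level \<eta> (2 ^ j)}) \<le> 2 / c * q ^ j"
  proof eventually_elim
    case (elim j)
    have "exp (- \<gamma> * ln (real (2 ^ j))) = q ^ j"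
      by (simp add: q_def ln_realpow exp_of_nat_mult[symmetric] mult_ac)
    then show ?case
      using elim by simp
  qed
  moreover have "summable (\<lambda>j. 2 / c * q ^ j)"
    using q by (intro summable_mult summable_geometric) simp
  ultimately show ?thesis
    by (rule summable_comparison_test_ev)
qed

text \<open>Purely deterministic. For n in a dyadic block, the maximal degree is at least that of a
  high vertex at the left end, while a maximiser inside the region would still have low degree at
  the right end. The levels use 1 / (k + 2) and 1 / (k + 1) respectively, so in late blocks the two
  statements contradict each other.\<close>

lemma ratio_of_maximizer_tendsto:
  fixes d :: "nat \<Rightarrow> nat \<Rightarrow> nat" and I :: "nat \<Rightarrow> nat"
  assumes mono: "\<And>n n' i. n \<le> n' \<Longrightarrow> d n i \<le> d n' i"
    and I: "\<And>n. n \<ge> 1 \<Longrightarrow> I n \<in> {1..n}" "\<And>n i. i \<in> {1..n} \<Longrightarrow> d n i \<le> d n (I n)"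
    and upper: "\<And>\<beta>. \<beta> \<in> \<rat> \<Longrightarrow> \<beta> \<noteq> \<mu> \<Longrightarrow> \<exists>k. \<forall>\<^sub>F j in sequentially.
      \<forall>i\<in>region \<beta> (2 ^ j). real (d (2 ^ j) i) < level (1 / real (Suc k)) (2 ^ j)"
    and lower: "\<And>k. \<forall>\<^sub>F j in sequentially.
      \<exists>i\<in>{1..2 ^ j}. level (1 / real (Suc (Suc k))) (2 ^ j) \<le> real (d (2 ^ j) i)"
  shows "(\<lambda>n. ln (real (I n)) / ln (real n)) \<longlonglongrightarrow> \<mu>"
proof -
  have avoid: "\<forall>\<^sub>F j in sequentially. \<forall>n. 2 ^ j \<le> n \<and> n \<le> 2 ^ Suc j \<longrightarrow> I n \<notin> region \<beta> (2 ^ Suc j)"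
    if \<beta>: "\<beta> \<in> \<rat>" "\<beta> \<noteq> \<mu>" for \<beta>
  proof -
    obtain k where k: "\<forall>\<^sub>F j in sequentially.
      \<forall>i\<in>region \<beta> (2 ^ j). real (d (2 ^ j) i) < level (1 / real (Suc k)) (2 ^ j)"
      using upper[OF \<beta>] by blast
    define a b where "a = 1 - 1 / real (Suc k)" and "b = 1 - 1 / real (Suc (Suc k))"
    have ab: "a < b"
      by (simp add: a_def b_def field_simps)
    \<comment> \<open>Equivalent to \<open>a * (j + 1) \<le> b * j\<close>: the level required at
      the left end is then at least the one forbidden at the right end.\<close>
    have "\<forall>\<^sub>F j in sequentially. a / (b - a) \<le> real j"
      using filterlim_real_sequentially by (simp add: filterlim_at_top)
    then show ?thesis
      using k[THEN eventually_compose_filterlim, OF filterlim_Suc] lower[of k]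
    proof eventually_elim
      case (elim j)
      show ?case
      proof (intro allI impI notI)
        fix n :: nat assume n: "2 ^ j \<le> n \<and> n \<le> 2 ^ Suc j" and In: "I n \<in> region \<beta> (2 ^ Suc j)"
        obtain i where i: "i \<in> {1..2 ^ j}" "level (1 / real (Suc (Suc k))) (2 ^ j) \<le> real (d (2 ^ j) i)"
          using elim(3) by blast
        have "level (1 / real (Suc (Suc k))) (2 ^ j) \<le> real (d n i)"
          using i(2) mono[of "2 ^ j" n i] n by linarith
        also have "\<dots> \<le> real (d n (I n))"
          using I(2)[of i n] i(1) n by auto
        also have "\<dots> \<le> real (d (2 ^ Suc j) (I n))"
          using mono[of n "2 ^ Suc j" "I n"] n by simp
        also have "\<dots> < level (1 / real (Suc k)) (2 ^ Suc j)"
          using elim(2) In by blast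
        finally have lt: "level (1 / real (Suc (Suc k))) (2 ^ j) < level (1 / real (Suc k)) (2 ^ Suc j)" .
        have "ln (real (2 ^ i)) = real i * ln 2" for i :: nat
          by (simp add: ln_realpow)
        then have "b * (real j * ln 2) / ln \<theta> < a * (real (Suc j) * ln 2) / ln \<theta>"
          using lt unfolding level_def a_def b_def by presburger
        then have "b * real j < a * real (Suc j)"
          using \<theta>_gt_1 by (simp add: divide_less_cancel)
        moreover have "a \<le> (b - a) * real j"
          using elim(1) ab by (simp add: divide_le_eq mult.commute)
        ultimately show False
          by (simp add: algebra_simps)
      qed
    qed
  qed
  have dyadic: "\<forall>\<^sub>F n in sequentially. P n"
    if P: "\<forall>\<^sub>F j in sequentially. \<forall>n. 2 ^ j \<le> n \<and> n \<le> 2 ^ Suc j \<longrightarrow> P n" for P :: "nat \<Rightarrow> bool"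
  proof -
    obtain J where J: "\<And>j n. j \<ge> J \<Longrightarrow> 2 ^ j \<le> n \<Longrightarrow> n \<le> 2 ^ Suc j \<Longrightarrow> P n"
      using P by (auto simp: eventually_sequentially)
    have "P n" if n: "n \<ge> 2 ^ J" for n
    proof -
      have "n \<ge> 1"
        using n by (meson le_trans one_le_numeral one_le_power)
      then obtain j where j: "2 ^ j \<le> n" "n < 2 ^ (j + 1)"
        using ex_power_ivl1[of 2 n] by auto
      have "(2::nat) ^ J < 2 ^ (j + 1)"
        using n j by linarith
      then have "J < j + 1"
        by (rule power_less_imp_less_exp[rotated]) simp
      then show ?thesis
        using J[of j n] j by simp
    qed
    then show ?thesis
      by (auto simp: eventually_sequentially)
  qed
  have ln_ge: "real j * ln 2 \<le> ln (real n)" if "2 ^ j \<le> n" for n j :: nat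
  proof -
    have "ln (real (2 ^ j)) \<le> ln (real n)"
      using that by (subst ln_le_cancel_iff)
        (auto simp del: of_nat_power intro: order_less_le_trans[of 0 "2 ^ j"])
    then show ?thesis
      by (simp add: ln_realpow)
  qed
  show ?thesis
  proof (rule order_tendstoI)
    fix a assume a: "a < \<mu>"
    \<comment> \<open>With \<beta> \<ge> 0 the bound \<open>\<beta> * ln n\<close> is monotone in n,
      so the one at the right end of a block covers the whole block.\<close>
    have "max a 0 < \<mu>"
      using a \<mu>_pos by simp
    then obtain \<beta> where "\<beta> \<in> \<rat>" "max a 0 < \<beta>" "\<beta> < \<mu>"
      using Rats_dense_in_real by blast
    then have \<beta>: "\<beta> < \<mu>" "0 \<le> \<beta>" "a \<le> \<beta>" "\<beta> \<in> \<rat>"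
      by auto
    have "\<forall>\<^sub>F j in sequentially. \<forall>n. 2 ^ j \<le> n \<and> n \<le> 2 ^ Suc j \<longrightarrow> \<beta> * ln (real n) < ln (real (I n))"
      using avoid[OF \<beta>(4) less_imp_neq[OF \<beta>(1)]]
    proof eventually_elim
      case (elim j)
      show ?case
      proof (intro allI impI)
        fix n :: nat assume n: "2 ^ j \<le> n \<and> n \<le> 2 ^ Suc j"
        have "n \<ge> 1"
          using n by (meson le_trans one_le_numeral one_le_power)
        then have In: "I n \<in> {1..2 ^ Suc j}"
          using I(1)[of n] n by auto
        moreover have "I n \<notin> region \<beta> (2 ^ Suc j)"
          using elim \<beta>(1) n by blast
        ultimately have "\<beta> * ln (real (2 ^ Suc j)) < ln (real (I n))"
          using \<beta>(1) unfolding region_def by auto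
        moreover have "\<beta> * ln (real n) \<le> \<beta> * ln (real (2 ^ Suc j))"
        proof (rule mult_left_mono[OF _ \<beta>(2)])
          show "ln (real n) \<le> ln (real (2 ^ Suc j))"
            using n \<open>n \<ge> 1\<close> by (subst ln_le_cancel_iff) (auto simp del: of_nat_power power_Suc)
        qed
        ultimately show "\<beta> * ln (real n) < ln (real (I n))"
          by linarith
      qed
    qed
    from dyadic[OF this] eventually_gt_at_top[of 1]
    show "\<forall>\<^sub>F n in sequentially. a < ln (real (I n)) / ln (real n)"
    proof eventually_elim
      case (elim n)
      then have "\<beta> < ln (real (I n)) / ln (real n)"
        by (simp add: less_divide_eq)
      then show ?case using \<beta> by linarith
    qed
  next
    fix a assume a: "\<mu> < a"
    obtain \<beta> where \<beta>: "\<mu> < \<beta>" "\<beta> < a" "\<beta> \<in> \<rat>"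
      using Rats_dense_in_real[OF a] by blast
    \<comment> \<open>The region refers to the right end \<open>2^(j+1)\<close>, but n may be as
      small as \<open>2^j\<close>; the condition says \<open>\<beta> * (j + 1) \<le> a * j\<close>
      and absorbs this.\<close>
    have "\<forall>\<^sub>F j in sequentially. \<beta> / (a - \<beta>) \<le> real j"
      using filterlim_real_sequentially by (simp add: filterlim_at_top)
    moreover have "\<beta> \<noteq> \<mu>" using \<beta> by simp
    note avoid[OF \<beta>(3) this]
    ultimately have "\<forall>\<^sub>F j in sequentially. \<forall>n. 2 ^ j \<le> n \<and> n \<le> 2 ^ Suc j \<longrightarrow> ln (real (I n)) < a * ln (real n)"
    proof eventually_elim
      case (elim j)
      show ?case
      proof (intro allI impI)
        fix n :: nat assume n: "2 ^ j \<le> n \<and> n \<le> 2 ^ Suc j"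
        have "n \<ge> 1"
          using n by (meson le_trans one_le_numeral one_le_power)
        then have In: "I n \<in> {1..2 ^ Suc j}"
          using I(1)[of n] n by auto
        moreover have "I n \<notin> region \<beta> (2 ^ Suc j)"
          using elim n by blast
        ultimately have "ln (real (I n)) < \<beta> * ln (real (2 ^ Suc j))"
          using \<beta>(1) unfolding region_def by auto
        also have "\<dots> = \<beta> * real (Suc j) * ln 2"
          using ln_realpow[of 2 "Suc j"] by (simp del: power_Suc)
        also have "\<dots> \<le> a * real j * ln 2"
        proof (rule mult_right_mono)
          have "\<beta> \<le> (a - \<beta>) * real j"
            using elim(1) \<beta> by (simp add: divide_le_eq mult.commute)
          then show "\<beta> * real (Suc j) \<le> a * real j"
            by (simp add: algebra_simps)
        qed simp
        also have "\<dots> = a * (real j * ln 2)"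
          by simp
        also have "\<dots> \<le> a * ln (real n)"
          using ln_ge[of j n] n \<beta> \<mu>_pos by (intro mult_left_mono) auto
        finally show "ln (real (I n)) < a * ln (real n)" .
      qed
    qed
    from dyadic[OF this] eventually_gt_at_top[of 1]
    show "\<forall>\<^sub>F n in sequentially. ln (real (I n)) / ln (real n) < a"
      by eventually_elim (simp add: divide_less_eq)
  qed
qed

end

section \<open>Averaging over the weights\<close>

text \<open>Hoeffding's inequality makes the deviation probabilities geometrically small in n, so
  Borel-Cantelli applies for each tolerance 1 / (k + 1).\<close>

lemma (in prob_space) strong_law_bounded_iid:
  fixes Y :: "nat \<Rightarrow> 'a \<Rightarrow> real"
  assumes indep: "indep_vars (\<lambda>_. borel) Y {1..}"
    and distr: "\<And>i. i \<ge> 1 \<Longrightarrow> distr M borel (Y i) = distr M borel (Y 1)"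
    and bounded: "AE \<omega> in M. Y 1 \<omega> \<in> {0..1}"
  shows "AE \<omega> in M. (\<lambda>n. (\<Sum>i=1..n. Y i \<omega>) / real n) \<longlonglongrightarrow> expectation (Y 1)"
proof -
  have Y: "Y i \<in> borel_measurable M" if "i \<ge> 1" for i
    using indep that unfolding indep_vars_def by auto
  have avg: "(\<lambda>\<omega>. (\<Sum>i=1..n. Y i \<omega>) / real n) \<in> borel_measurable M" for n
    by (intro borel_measurable_divide borel_measurable_sum Y) auto
  define A where "A k n = {\<omega> \<in> space M. 1 / real (Suc k) \<le> \<bar>(\<Sum>i=1..n. Y i \<omega>) / real n - expectation (Y 1)\<bar>}" for k n
  have A_sets: "A k n \<in> sets M" for k n
    unfolding A_def using avg[of n] by measurable
  have prob_A: "prob (A k n) \<le> 2 * exp (- 2 * (1 / real (Suc k))\<^sup>2) ^ n" if n: "n \<ge> 1" for k n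
  proof -
    interpret Hoeffding_ineq_iid M "{1..n}" Y "Y 1" 0 1 "expectation (Y 1)"
    proof unfold_locales
      show "indep_vars (\<lambda>_. borel) Y {1..n}"
        by (rule indep_vars_subset[OF indep]) auto
      show "distr M borel (Y i) = distr M borel (Y 1)" if "i \<in> {1..n}" for i
        using that by (intro distr) simp
    qed (use Y bounded in auto)
    have "prob (A k n) \<le> 2 * exp (- 2 * real n * (1 / real (Suc k))\<^sup>2)"
      using Hoeffding_ineq_abs_ge'[of "1 / real (Suc k)"] n by (simp add: A_def del: expectation_X)
    also have "- 2 * real n * (1 / real (Suc k))\<^sup>2 = real n * (- 2 * (1 / real (Suc k))\<^sup>2)"
      by simp
    finally show ?thesis
      by (simp only: exp_of_nat_mult)
  qed
  have "AE \<omega> in M. \<forall>\<^sub>F n in sequentially. \<omega> \<in> space M - A k n" for k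
  proof (rule borel_cantelli_AE1[OF A_sets])
    have "summable (\<lambda>n. 2 * exp (- 2 * (1 / real (Suc k))\<^sup>2) ^ n)"
      by (intro summable_mult summable_geometric) simp
    then show "summable (\<lambda>n. measure M (A k n))"
      by (rule summable_comparison_test_ev[rotated])
        (use prob_A in \<open>auto simp: eventually_sequentially intro!: exI[of _ 1]\<close>)
  qed (simp add: less_top[symmetric])
  then have "AE \<omega> in M. \<forall>k. \<forall>\<^sub>F n in sequentially. \<omega> \<in> space M - A k n"
    by (simp add: AE_all_countable)
  then show ?thesis
  proof eventually_elim
    case (elim \<omega>)
    show ?case
    proof (rule tendstoI)
      fix e :: real assume "e > 0"
      then obtain k where k: "1 / real (Suc k) < e"
        using nat_approx_posE by blast
      from elim have "\<forall>\<^sub>F n in sequentially. \<omega> \<in> space M - A k n"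
        by blast
      then show "\<forall>\<^sub>F n in sequentially. dist ((\<Sum>i=1..n. Y i \<omega>) / real n) (expectation (Y 1)) < e"
        by eventually_elim (use k in \<open>auto simp: A_def dist_real_def\<close>)
    qed
  qed
qed

section \<open>The law of the graph given the weights\<close>

definition trajectories :: "nat \<Rightarrow> nat \<Rightarrow> (nat \<times> nat \<Rightarrow> nat) set" where
  "trajectories m n = PiE_dflt (half_edges m n) 0 (\<lambda>a. {1..fst a - 1})"

lemma finite_trajectories [simp]: "finite (trajectories m n)"
  unfolding trajectories_def by (rule finite_PiE_dflt) auto

text \<open>As a finite sum of products, the probability is visibly measurable in the weights, and
  each summand can be matched with one trajectory of the random graph.\<close>

lemma prob_quenched_pmf:
  assumes w: "\<And>i. i \<ge> 1 \<Longrightarrow> w i > 0"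
  shows "measure_pmf.prob (quenched_pmf w m n) D =
    (\<Sum>x\<in>D \<inter> trajectories m n. \<Prod>a\<in>half_edges m n. pmf (attach_pmf w (fst a - 1)) (x a))"
proof -
  have "set_pmf (quenched_pmf w m n) \<subseteq> trajectories m n"
  proof
    fix x assume "x \<in> set_pmf (quenched_pmf w m n)"
    then have x: "x \<in> PiE_dflt (half_edges m n) 0 (set_pmf \<circ> (\<lambda>a. attach_pmf w (fst a - 1)))"
      unfolding quenched_pmf_def by (simp add: set_Pi_pmf)
    have "set_pmf (attach_pmf w (fst a - 1)) \<subseteq> {1..fst a - 1}" if "a \<in> half_edges m n" for a
      using that by (intro set_attach_pmf w) (auto simp: half_edges_def)
    then show "x \<in> trajectories m n"
      using x unfolding trajectories_def PiE_dflt_def comp_def mem_Collect_eq by blast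
  qed
  then have "measure_pmf.prob (quenched_pmf w m n) D =
      measure_pmf.prob (quenched_pmf w m n) (D \<inter> trajectories m n)"
    by (intro measure_prob_cong_0) (auto simp: set_pmf_iff)
  also have "\<dots> = (\<Sum>x\<in>D \<inter> trajectories m n. pmf (quenched_pmf w m n) x)"
    by (rule measure_measure_pmf_finite) simp
  also have "\<dots> = (\<Sum>x\<in>D \<inter> trajectories m n. \<Prod>a\<in>half_edges m n. pmf (attach_pmf w (fst a - 1)) (x a))"
    unfolding quenched_pmf_def
    by (intro sum.cong refl pmf_Pi') (auto simp: trajectories_def PiE_dflt_def)
  finally show ?thesis .
qed

lemma in_degree_wrg_graph:
  "in_degree (wrg_graph m X n \<omega>) i = card {a \<in> half_edges m n. X (fst a) (snd a) \<omega> = i}"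
  by (simp add: in_degree_def in_arcs_def wrg_graph_def half_edges_def case_prod_unfold)

lemma max_degree_label_maximizes:
  assumes "n \<ge> 1"
  shows "max_degree_label m X n \<omega> \<in> {1..n}"
    and "i \<in> {1..n} \<Longrightarrow> in_degree (wrg_graph m X n \<omega>) i \<le>
      in_degree (wrg_graph m X n \<omega>) (max_degree_label m X n \<omega>)"
proof -
  let ?d = "in_degree (wrg_graph m X n \<omega>)"
  let ?K = "{i \<in> {1..n}. \<forall>j\<in>{1..n}. ?d j \<le> ?d i}"
  have "Max (?d ` {1..n}) \<in> ?d ` {1..n}"
    using assms by (intro Max_in) auto
  then obtain k where k: "k \<in> {1..n}" "?d k = Max (?d ` {1..n})"
    by auto
  then have "k \<in> ?K"
    by auto
  then have "Inf ?K \<in> ?K"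
    by (intro Inf_nat_def1) blast
  then show "max_degree_label m X n \<omega> \<in> {1..n}"
    "i \<in> {1..n} \<Longrightarrow> ?d i \<le> ?d (max_degree_label m X n \<omega>)"
    unfolding max_degree_label_def by auto
qed

context weighted_recursive_graph
begin

abbreviation history :: "nat \<Rightarrow> 'a measure" where
  "history n \<equiv> wrg_history M m W X n"

text \<open>The random graph as a point of the sample space of \<open>quenched_pmf\<close>, with the
  same value 0 off the half-edges.\<close>

definition half_edge_targets :: "nat \<Rightarrow> 'a \<Rightarrow> nat \<times> nat \<Rightarrow> nat" where
  "half_edge_targets n \<omega> a = (if a \<in> half_edges m n then X (fst a) (snd a) \<omega> else 0)"

text \<open>A plain quotient in place of \<open>attach_pmf\<close>, so that measurability is clear
  for every \<omega>, even where weights fail to be positive; almost surely the two agree.\<close>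

definition attach_prob :: "'a \<Rightarrow> nat \<Rightarrow> nat \<Rightarrow> real" where
  "attach_prob \<omega> k i = (if i \<in> {1..k} then W i \<omega> / total_weight W k \<omega> else 0)"

lemma W_measurable [measurable]: "i \<ge> 1 \<Longrightarrow> W i \<in> borel_measurable M"
  using W_indep unfolding M.indep_vars_def by auto

lemma AE_W:
  assumes "Measurable.pred borel P" "AE x in N. P (V x)"
  shows "AE \<omega> in M. \<forall>i\<ge>1. P (W i \<omega>)"
proof -
  have "AE \<omega> in M. P (W i \<omega>)" if i: "i \<ge> 1" for i
  proof -
    have "AE x in distr N borel V. P x"
      using assms V_measurable by (subst AE_distr_iff) auto
    then have "AE x in distr M borel (W i). P x"
      unfolding W_copies[OF i] .
    then show ?thesis
      using assms(1) W_measurable[OF i] by (subst (asm) AE_distr_iff) auto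
  qed
  then show ?thesis
    by (simp add: AE_all_countable)
qed

lemma history_Pow:
  "{W i -` B \<inter> space M | i B. i \<ge> 1 \<and> B \<in> sets borel} \<union>
    {X k l -` {j} \<inter> space M | k l j. k \<in> {2..n} \<and> l \<in> {1..m}} \<subseteq> Pow (space M)"
  by blast

lemma space_history [simp]: "space (history n) = space M"
  unfolding wrg_history_def by (rule space_measure_of[OF history_Pow])

lemma sets_history: "sets (history n) = sigma_sets (space M)
    ({W i -` B \<inter> space M | i B. i \<ge> 1 \<and> B \<in> sets borel} \<union>
     {X k l -` {j} \<inter> space M | k l j. k \<in> {2..n} \<and> l \<in> {1..m}})"
  unfolding wrg_history_def by (rule sets_measure_of[OF history_Pow])

lemma W_history:
  assumes "i \<ge> 1"
  shows "W i \<in> borel_measurable (history n)"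
proof (rule measurableI)
  fix B :: "real set" assume "B \<in> sets borel"
  then show "W i -` B \<inter> space (history n) \<in> sets (history n)"
    using assms unfolding sets_history space_history by (intro sigma_sets.Basic) blast
qed simp

lemma X_history:
  assumes "k \<in> {2..n}" "l \<in> {1..m}"
  shows "{\<omega> \<in> space M. X k l \<omega> = j} \<in> sets (history n)"
proof -
  have "{\<omega> \<in> space M. X k l \<omega> = j} = X k l -` {j} \<inter> space M"
    by auto
  then show ?thesis
    using assms unfolding sets_history by (intro sigma_sets.Basic) blast
qed

lemma measurable_history_mono:
  assumes "k \<le> n" "f \<in> borel_measurable (history k)"
  shows "f \<in> borel_measurable (history n)"
proof (rule measurable_from_subalg[OF _ assms(2)])
  have "{2..k} \<subseteq> {2..n}"
    using assms(1) by simp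
  then have "{X k' l -` {j} \<inter> space M | k' l j. k' \<in> {2..k} \<and> l \<in> {1..m}} \<subseteq>
      {X k l -` {j} \<inter> space M | k l j. k \<in> {2..n} \<and> l \<in> {1..m}}"
    by blast
  then show "subalgebra (history n) (history k)"
    unfolding subalgebra_def space_history sets_history
    by (intro conjI refl sigma_sets_mono' Un_mono order_refl)
qed

lemma attach_prob_history:
  shows "(\<lambda>\<omega>. attach_prob \<omega> k i) \<in> borel_measurable (history n)"
proof (cases "i \<in> {1..k}")
  case True
  then have "(\<lambda>\<omega>. W i \<omega> / (\<Sum>j=1..k. W j \<omega>)) \<in> borel_measurable (history n)"
    by (intro borel_measurable_divide borel_measurable_sum W_history) auto
  then show ?thesis
    using True by (simp add: attach_prob_def total_weight_def)
qed (auto simp: attach_prob_def)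

lemma X_range:
  assumes "a \<in> half_edges m n" "\<omega> \<in> space M"
  shows "X (fst a) (snd a) \<omega> \<in> {1..fst a - 1}"
proof -
  have "X (fst a - 1 + 1) (snd a) \<in> M \<rightarrow>\<^sub>M count_space {1..fst a - 1}"
    using assms(1) by (intro X_measurable) (auto simp: half_edges_def)
  from measurable_space[OF this assms(2)] show ?thesis
    using assms(1) by (auto simp: half_edges_def)
qed

lemma AE_attach_prob: "AE \<omega> in M. \<forall>k i. \<bar>attach_prob \<omega> k i\<bar> \<le> 1"
proof -
  have "AE \<omega> in M. \<forall>i\<ge>1. W i \<omega> > 0"
    using V_pos by (intro AE_W) auto
  then show ?thesis
  proof eventually_elim
    case (elim \<omega>)
    show ?case
    proof (intro allI)
      fix k i
      show "\<bar>attach_prob \<omega> k i\<bar> \<le> 1"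
      proof (cases "i \<in> {1..k}")
        case True
        have "W i \<omega> \<le> (\<Sum>j=1..k. W j \<omega>)"
          using True elim by (intro member_le_sum) (auto intro: less_imp_le)
        moreover have "W i \<omega> > 0"
          using True elim by auto
        ultimately show ?thesis
          using True by (simp add: attach_prob_def total_weight_def)
      qed (auto simp: attach_prob_def)
    qed
  qed
qed

lemma half_edges_Suc:
  "n \<ge> 1 \<Longrightarrow> half_edges m (Suc n) = half_edges m n \<union> {Suc n} \<times> {1..m}"
  by (auto simp: half_edges_def)

lemma X_trajectory_sets:
  "{\<omega> \<in> space M. \<forall>a\<in>half_edges m n. X (fst a) (snd a) \<omega> = x a} \<in> sets (history n)"
proof -
  have "{\<omega> \<in> space (history n). X (fst a) (snd a) \<omega> = x a} \<in> sets (history n)" if "a \<in> half_edges m n" for a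
    using that X_history[of "fst a" n "snd a" "x a"] by (auto simp: half_edges_def)
  then have "{\<omega> \<in> space (history n). \<forall>a\<in>half_edges m n. X (fst a) (snd a) \<omega> = x a} \<in> sets (history n)"
    by (intro sets.sets_Collect_finite_All) auto
  then show ?thesis by simp
qed

text \<open>This is the integrated form of the product formula for a trajectory given the weights.
  Since half-edges start at vertex 2, \<open>history 1\<close> is the \<sigma>-algebra of the
  weights alone, and h is a bounded test function on it. The induction conditions on the history
  before the last vertex.\<close>

lemma integral_trajectory:
  assumes "n \<ge> 1" "h \<in> borel_measurable (history 1)" "AE \<omega> in M. \<bar>h \<omega>\<bar> \<le> 1"
  shows "(\<integral>\<omega>. h \<omega> * indicat_real {\<omega> \<in> space M. \<forall>a\<in>half_edges m n. X (fst a) (snd a) \<omega> = x a} \<omega> \<partial>M) =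
    (\<integral>\<omega>. h \<omega> * (\<Prod>a\<in>half_edges m n. attach_prob \<omega> (fst a - 1) (x a)) \<partial>M)"
  using assms
proof (induction n arbitrary: h rule: nat_induct_at_least)
  case base
  have "half_edges m 1 = {}"
    by (auto simp: half_edges_def)
  then show ?case
    by (auto intro!: Bochner_Integration.integral_cong)
next
  case (Suc n)
  define v where "v l = x (Suc n, l)" for l
  define R where "R = {\<omega> \<in> space M. \<forall>l\<in>{1..m}. X (n + 1) l \<omega> = v l}"
  define A where "A k = {\<omega> \<in> space M. \<forall>a\<in>half_edges m k. X (fst a) (snd a) \<omega> = x a}" for k
  define p where "p \<omega> = (\<Prod>l=1..m. attach_prob \<omega> n (v l))" for \<omega>
  have A_Suc: "A (Suc n) = A n \<inter> R"
    unfolding A_def R_def half_edges_Suc[OF Suc.hyps] ball_Un v_def Suc_eq_plus1[symmetric]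
    by (auto simp del: One_nat_def)
  have prod_Suc: "(\<Prod>a\<in>half_edges m (Suc n). attach_prob \<omega> (fst a - 1) (x a)) =
      p \<omega> * (\<Prod>a\<in>half_edges m n. attach_prob \<omega> (fst a - 1) (x a))" for \<omega>
  proof -
    have "(\<Prod>a\<in>{Suc n} \<times> {1..m}. attach_prob \<omega> (fst a - 1) (x a)) = p \<omega>"
      unfolding p_def v_def by (rule prod.reindex_bij_witness[of _ "\<lambda>l. (Suc n, l)" snd]) auto
    then show ?thesis
      unfolding half_edges_Suc[OF Suc.hyps]
      by (subst prod.union_disjoint) (auto simp: half_edges_def mult.commute)
  qed
  have "subalgebra M (history n)"
    by (rule subalgebra_wrg_history)
  then interpret finite_measure_subalgebra M "history n"
    by unfold_locales
  have h_n: "h \<in> borel_measurable (history n)"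
    using Suc by (intro measurable_history_mono[of 1 n]) auto
  have A_n: "A n \<in> sets (history n)"
    unfolding A_def by (rule X_trajectory_sets)
  have A_M: "A k \<in> sets M" for k
    unfolding A_def using X_trajectory_sets[of k] subalgebra_wrg_history[of k] by (auto simp: subalgebra_def)
  have p_1: "p \<in> borel_measurable (history 1)"
    unfolding p_def by (intro borel_measurable_prod attach_prob_history)
  have p_AE: "AE \<omega> in M. \<bar>p \<omega>\<bar> \<le> 1"
    using AE_attach_prob
    by eventually_elim (auto simp: p_def abs_prod intro!: prod_le_1)
  show ?case
  proof (cases "v \<in> {1..m} \<rightarrow> {1..n}")
    \<comment> \<open>\<open>attach\<close> covers only targets among the existing vertices; for all
      others both sides vanish.\<close>
    case False
    then obtain l where l: "l \<in> {1..m}" "v l \<notin> {1..n}"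
      unfolding Pi_iff by blast
    have "R = {}"
    proof (rule ccontr)
      assume "R \<noteq> {}"
      then obtain \<omega> where \<omega>: "\<omega> \<in> space M" "X (Suc n) l \<omega> = v l"
        using l by (auto simp: R_def)
      have "(Suc n, l) \<in> half_edges m (Suc n)"
        using l Suc.hyps by (auto simp: half_edges_def)
      from X_range[OF this \<omega>(1)] show False
        using \<omega>(2) l by simp
    qed
    moreover have "p \<omega> = 0" for \<omega>
      unfolding p_def using l by (intro prod_zero) (auto simp: attach_prob_def)
    ultimately show ?thesis
      unfolding A_def[symmetric] A_Suc prod_Suc by simp
  next
    case True
    have R_M: "R \<in> sets M"
      unfolding R_def
    proof (rule sets.sets_Collect_finite_All)
      fix l assume "l \<in> {1..m}"
      then show "{\<omega> \<in> space M. X (n + 1) l \<omega> = v l} \<in> sets M"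
        using X_history[of "n + 1" "n + 1" l "v l"] subalgebra_wrg_history[of "n + 1"] Suc.hyps
        by (auto simp: subalgebra_def)
    qed auto
    \<comment> \<open>Everything up to time n is measurable for the conditioning history, so only
      the indicator of the new attachment is replaced by its conditional expectation.\<close>
    define f where "f \<omega> = h \<omega> * indicat_real (A n) \<omega>" for \<omega>
    have f_n: "f \<in> borel_measurable (history n)"
      unfolding f_def using h_n A_n by measurable
    have f_M: "f \<in> borel_measurable M"
      by (rule measurable_from_subalg[OF subalgebra_wrg_history f_n])
    have R_borel: "indicat_real R \<in> borel_measurable M"
      using R_M by measurable
    have int: "integrable M (\<lambda>\<omega>. f \<omega> * indicat_real R \<omega>)"
    proof (rule M.integrable_const_bound[where B = 1])
      show "AE \<omega> in M. norm (f \<omega> * indicat_real R \<omega>) \<le> 1"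
        using Suc.prems(2) by eventually_elim (auto simp: f_def indicator_def)
      show "(\<lambda>\<omega>. f \<omega> * indicat_real R \<omega>) \<in> borel_measurable M"
        using f_M R_borel by measurable
    qed
    have "(\<integral>\<omega>. h \<omega> * indicat_real (A (Suc n)) \<omega> \<partial>M) = (\<integral>\<omega>. f \<omega> * indicat_real R \<omega> \<partial>M)"
      by (intro Bochner_Integration.integral_cong) (auto simp: A_Suc f_def indicator_def)
    also have "\<dots> = (\<integral>\<omega>. f \<omega> * real_cond_exp M (history n) (indicat_real R) \<omega> \<partial>M)"
      by (rule real_cond_exp_intg(2)[OF int f_n R_borel, symmetric])
    also have "\<dots> = (\<integral>\<omega>. f \<omega> * p \<omega> \<partial>M)"
    proof (rule integral_cong_AE)
      have p_M: "p \<in> borel_measurable M"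
        by (rule measurable_from_subalg[OF subalgebra_wrg_history p_1])
      then show "(\<lambda>\<omega>. f \<omega> * p \<omega>) \<in> borel_measurable M"
        using f_M by measurable
      show "(\<lambda>\<omega>. f \<omega> * real_cond_exp M (history n) (indicat_real R) \<omega>) \<in> borel_measurable M"
        using f_M by measurable
      have "AE \<omega> in M. real_cond_exp M (history n) (indicat_real R) \<omega> =
          (\<Prod>l=1..m. W (v l) \<omega> / total_weight W n \<omega>)"
        unfolding R_def by (rule attach[OF Suc.hyps True])
      then show "AE \<omega> in M. f \<omega> * real_cond_exp M (history n) (indicat_real R) \<omega> = f \<omega> * p \<omega>"
      proof eventually_elim
        case (elim \<omega>)
        have "p \<omega> = (\<Prod>l=1..m. W (v l) \<omega> / total_weight W n \<omega>)"
          unfolding p_def using True by (intro prod.cong) (auto simp: attach_prob_def Pi_iff)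
        then show ?case
          using elim by simp
      qed
    qed
    \<comment> \<open>p depends on the weights alone, so it joins the test function; this is why the
      induction runs over arbitrary h.\<close>
    also have "\<dots> = (\<integral>\<omega>. (h \<omega> * p \<omega>) * indicat_real (A n) \<omega> \<partial>M)"
      by (simp add: f_def mult_ac)
    also have "\<dots> = (\<integral>\<omega>. (h \<omega> * p \<omega>) * (\<Prod>a\<in>half_edges m n. attach_prob \<omega> (fst a - 1) (x a)) \<partial>M)"
      unfolding A_def
    proof (rule Suc.IH)
      show "(\<lambda>\<omega>. h \<omega> * p \<omega>) \<in> borel_measurable (history 1)"
        using Suc.prems(1) p_1 by measurable
      show "AE \<omega> in M. \<bar>h \<omega> * p \<omega>\<bar> \<le> 1"
        using Suc.prems(2) p_AE by eventually_elim (simp add: abs_mult mult_le_one)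
    qed
    finally show ?thesis
      unfolding A_def[symmetric] prod_Suc by (simp add: mult_ac)
  qed
qed

text \<open>A version of the conditional probability, given the weights, that the half-edge targets
  lie in D.\<close>

definition quenched_prob :: "nat \<Rightarrow> (nat \<times> nat \<Rightarrow> nat) set \<Rightarrow> 'a \<Rightarrow> real" where
  "quenched_prob n D \<omega> =
    (\<Sum>x\<in>D \<inter> trajectories m n. \<Prod>a\<in>half_edges m n. attach_prob \<omega> (fst a - 1) (x a))"

lemma quenched_prob_history: "quenched_prob n D \<in> borel_measurable (history k)"
  unfolding quenched_prob_def by (intro borel_measurable_sum borel_measurable_prod attach_prob_history)

text \<open>The exceptional set comes from nonpositive weights and so serves all n and D at
  once.\<close>

lemma AE_quenched_prob:
  "AE \<omega> in M. \<forall>n D. quenched_prob n D \<omega> = measure_pmf.prob (quenched_pmf (\<lambda>i. W i \<omega>) m n) D"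
proof -
  have "AE \<omega> in M. \<forall>i\<ge>1. W i \<omega> > 0"
    using V_pos by (intro AE_W) auto
  then show ?thesis
  proof eventually_elim
    case (elim \<omega>)
    have "attach_prob \<omega> (fst a - 1) i = pmf (attach_pmf (\<lambda>i. W i \<omega>) (fst a - 1)) i" if "a \<in> half_edges m n" for a n i
      using elim that by (subst pmf_attach_pmf) (auto simp: attach_prob_def total_weight_def half_edges_def)
    then show ?case
      using elim by (simp add: prob_quenched_pmf quenched_prob_def)
  qed
qed

lemma half_edge_targets_trajectories:
  "\<omega> \<in> space M \<Longrightarrow> half_edge_targets n \<omega> \<in> trajectories m n"
  using X_range[of _ n \<omega>] by (auto simp: trajectories_def PiE_dflt_def half_edge_targets_def)

lemma half_edge_targets_eq_iff:
  assumes "x \<in> trajectories m n"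
  shows "half_edge_targets n \<omega> = x \<longleftrightarrow> (\<forall>a\<in>half_edges m n. X (fst a) (snd a) \<omega> = x a)"
  using assms by (auto simp: trajectories_def PiE_dflt_def half_edge_targets_def fun_eq_iff)

lemma half_edge_targets_sets [measurable]:
  "{\<omega> \<in> space M. half_edge_targets n \<omega> \<in> D} \<in> sets M"
proof -
  have "{\<omega> \<in> space M. half_edge_targets n \<omega> \<in> D} = (\<Union>x\<in>D \<inter> trajectories m n.
      {\<omega> \<in> space M. \<forall>a\<in>half_edges m n. X (fst a) (snd a) \<omega> = x a})"
  proof (intro equalityI subsetI)
    fix \<omega> assume "\<omega> \<in> {\<omega> \<in> space M. half_edge_targets n \<omega> \<in> D}"
    then show "\<omega> \<in> (\<Union>x\<in>D \<inter> trajectories m n.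
        {\<omega> \<in> space M. \<forall>a\<in>half_edges m n. X (fst a) (snd a) \<omega> = x a})"
      using half_edge_targets_trajectories[of \<omega> n] half_edge_targets_eq_iff[of "half_edge_targets n \<omega>" n \<omega>]
      by (intro UN_I[of "half_edge_targets n \<omega>"]) auto
  next
    fix \<omega> assume "\<omega> \<in> (\<Union>x\<in>D \<inter> trajectories m n.
        {\<omega> \<in> space M. \<forall>a\<in>half_edges m n. X (fst a) (snd a) \<omega> = x a})"
    then obtain x where "x \<in> D" "x \<in> trajectories m n" "\<omega> \<in> space M"
      "\<forall>a\<in>half_edges m n. X (fst a) (snd a) \<omega> = x a"
      by blast
    then show "\<omega> \<in> {\<omega> \<in> space M. half_edge_targets n \<omega> \<in> D}"
      using half_edge_targets_eq_iff[of x n \<omega>] by simp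
  qed
  also have "\<dots> \<in> sets M"
    using X_trajectory_sets subalgebra_wrg_history[of n]
    by (intro sets.finite_UN) (auto simp: subalgebra_def)
  finally show ?thesis .
qed

lemma integral_quenched_prob:
  assumes "n \<ge> 1" "h \<in> borel_measurable (history 1)" "AE \<omega> in M. \<bar>h \<omega>\<bar> \<le> 1"
  shows "(\<integral>\<omega>. h \<omega> * indicat_real {\<omega> \<in> space M. half_edge_targets n \<omega> \<in> D} \<omega> \<partial>M) =
    (\<integral>\<omega>. h \<omega> * quenched_prob n D \<omega> \<partial>M)"
proof -
  define A where "A x = {\<omega> \<in> space M. \<forall>a\<in>half_edges m n. X (fst a) (snd a) \<omega> = x a}" for x
  define p where "p x \<omega> = (\<Prod>a\<in>half_edges m n. attach_prob \<omega> (fst a - 1) (x a))" for x \<omega>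
  have h_M: "h \<in> borel_measurable M"
    by (rule measurable_from_subalg[OF subalgebra_wrg_history assms(2)])
  have A_M: "A x \<in> sets M" for x
    unfolding A_def using X_trajectory_sets[of n x] subalgebra_wrg_history[of n] by (auto simp: subalgebra_def)
  have int_A: "integrable M (\<lambda>\<omega>. h \<omega> * indicat_real (A x) \<omega>)" for x
  proof (rule M.integrable_const_bound[where B = 1])
    show "AE \<omega> in M. norm (h \<omega> * indicat_real (A x) \<omega>) \<le> 1"
      using assms(3) by eventually_elim (auto simp: indicator_def)
    show "(\<lambda>\<omega>. h \<omega> * indicat_real (A x) \<omega>) \<in> borel_measurable M"
      using h_M A_M[of x] by measurable
  qed
  have int_p: "integrable M (\<lambda>\<omega>. h \<omega> * p x \<omega>)" for x
  proof (rule M.integrable_const_bound[where B = 1])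
    show "AE \<omega> in M. norm (h \<omega> * p x \<omega>) \<le> 1"
      using assms(3) AE_attach_prob
      by eventually_elim (auto simp: p_def abs_mult abs_prod intro!: mult_le_one prod_le_1 prod_nonneg)
    have "p x \<in> borel_measurable (history 1)"
      unfolding p_def by (intro borel_measurable_prod attach_prob_history)
    then have "p x \<in> borel_measurable M"
      by (rule measurable_from_subalg[OF subalgebra_wrg_history])
    then show "(\<lambda>\<omega>. h \<omega> * p x \<omega>) \<in> borel_measurable M"
      using h_M by measurable
  qed
  have "(\<integral>\<omega>. h \<omega> * indicat_real {\<omega> \<in> space M. half_edge_targets n \<omega> \<in> D} \<omega> \<partial>M) =
      (\<integral>\<omega>. (\<Sum>x\<in>D \<inter> trajectories m n. h \<omega> * indicat_real (A x) \<omega>) \<partial>M)"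
  proof (rule Bochner_Integration.integral_cong[OF refl])
    fix \<omega> assume \<omega>: "\<omega> \<in> space M"
    have "(\<Sum>x\<in>D \<inter> trajectories m n. indicat_real (A x) \<omega>) =
        (\<Sum>x\<in>D \<inter> trajectories m n. if x = half_edge_targets n \<omega> then 1 else 0)"
      using \<omega> half_edge_targets_eq_iff[of _ n \<omega>] by (intro sum.cong) (auto simp: A_def indicator_def)
    also have "\<dots> = indicat_real {\<omega> \<in> space M. half_edge_targets n \<omega> \<in> D} \<omega>"
      using \<omega> half_edge_targets_trajectories[OF \<omega>, of n] by (simp add: indicator_def)
    finally show "h \<omega> * indicat_real {\<omega> \<in> space M. half_edge_targets n \<omega> \<in> D} \<omega> =
        (\<Sum>x\<in>D \<inter> trajectories m n. h \<omega> * indicat_real (A x) \<omega>)"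
      by (simp add: sum_distrib_left[symmetric])
  qed
  also have "\<dots> = (\<Sum>x\<in>D \<inter> trajectories m n. \<integral>\<omega>. h \<omega> * indicat_real (A x) \<omega> \<partial>M)"
    using int_A by (intro Bochner_Integration.integral_sum) auto
  also have "\<dots> = (\<Sum>x\<in>D \<inter> trajectories m n. \<integral>\<omega>. h \<omega> * p x \<omega> \<partial>M)"
    unfolding A_def p_def by (intro sum.cong refl integral_trajectory assms)
  also have "\<dots> = (\<integral>\<omega>. (\<Sum>x\<in>D \<inter> trajectories m n. h \<omega> * p x \<omega>) \<partial>M)"
    using int_p by (intro Bochner_Integration.integral_sum[symmetric]) auto
  finally show ?thesis
    by (simp add: quenched_prob_def p_def sum_distrib_left)
qed

text \<open>Almost sure convergence of the quenched series does not make the expected probabilities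
  summable. Restricting to weights for which the series is at most C bounds the sum of the
  expectations by C, and the natural numbers C exhaust the weights with a convergent series.\<close>

lemma quenched_borel_cantelli:
  assumes n: "\<And>j. n j \<ge> 1"
  shows "AE \<omega> in M. summable (\<lambda>j. measure_pmf.prob (quenched_pmf (\<lambda>i. W i \<omega>) m (n j)) (D j)) \<longrightarrow>
    (\<forall>\<^sub>F j in sequentially. half_edge_targets (n j) \<omega> \<notin> D j)"
proof -
  define q where "q j = quenched_prob (n j) (D j)" for j
  define B where "B j = {\<omega> \<in> space M. half_edge_targets (n j) \<omega> \<in> D j}" for j
  \<comment> \<open>On these events, which depend on the weights only, the quenched probabilities have a bounded sum.\<close>
  define E where "E C = {\<omega> \<in> space M. \<forall>J. (\<Sum>j<J. q j \<omega>) \<le> real C}" for C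
  have B_M: "B j \<in> sets M" for j
    unfolding B_def by (rule half_edge_targets_sets)
  have q_1: "q j \<in> borel_measurable (history 1)" for j
    unfolding q_def by (rule quenched_prob_history)
  have E_1: "E C \<in> sets (history 1)" for C
  proof -
    have "{\<omega> \<in> space (history 1). (\<Sum>j<J. q j \<omega>) \<le> real C} \<in> sets (history 1)" for J
      using q_1 by measurable
    then have "{\<omega> \<in> space (history 1). \<forall>J. (\<Sum>j<J. q j \<omega>) \<le> real C} \<in> sets (history 1)"
      by (intro sets.sets_Collect_countable_All) auto
    then show ?thesis
      by (simp add: E_def)
  qed
  have E_M: "E C \<in> sets M" for C
    using E_1 subalgebra_wrg_history[of 1] by (auto simp: subalgebra_def)
  have q_prob: "AE \<omega> in M. \<forall>j. q j \<omega> = measure_pmf.prob (quenched_pmf (\<lambda>i. W i \<omega>) m (n j)) (D j)"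
    using AE_quenched_prob by eventually_elim (simp add: q_def)
  have int_q: "integrable M (\<lambda>\<omega>. indicat_real (E C) \<omega> * q j \<omega>)" for C j
  proof (rule M.integrable_const_bound[where B = 1])
    show "AE \<omega> in M. norm (indicat_real (E C) \<omega> * q j \<omega>) \<le> 1"
      using q_prob by eventually_elim (auto simp: indicator_def)
    have "q j \<in> borel_measurable M"
      by (rule measurable_from_subalg[OF subalgebra_wrg_history q_1])
    then show "(\<lambda>\<omega>. indicat_real (E C) \<omega> * q j \<omega>) \<in> borel_measurable M"
      using E_M[of C] by measurable
  qed
  \<comment> \<open>The indicator of \<open>E C\<close> serves as test function, so on
    \<open>E C\<close> the event \<open>B j\<close> can be replaced by its quenched
    probability.\<close>
  have prob_EB: "M.prob (E C \<inter> B j) = (\<integral>\<omega>. indicat_real (E C) \<omega> * q j \<omega> \<partial>M)" for C j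
  proof -
    have "M.prob (E C \<inter> B j) = (\<integral>\<omega>. indicat_real (E C) \<omega> * indicat_real (B j) \<omega> \<partial>M)"
      using E_M[of C] B_M[of j] by (simp add: indicator_inter_arith[symmetric] )
    also have "\<dots> = (\<integral>\<omega>. indicat_real (E C) \<omega> * q j \<omega> \<partial>M)"
      unfolding B_def q_def using E_1[of C] by (intro integral_quenched_prob n) auto
    finally show ?thesis .
  qed
  have "AE \<omega> in M. \<forall>\<^sub>F j in sequentially. \<omega> \<in> space M - (E C \<inter> B j)" for C
  proof (rule borel_cantelli_AE1)
    show "E C \<inter> B j \<in> sets M" for j
      using E_M B_M by auto
    show "summable (\<lambda>j. M.prob (E C \<inter> B j))"
    proof (rule summableI_nonneg_bounded)
      fix J
      have "(\<Sum>j<J. M.prob (E C \<inter> B j)) = (\<integral>\<omega>. (\<Sum>j<J. indicat_real (E C) \<omega> * q j \<omega>) \<partial>M)"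
        unfolding prob_EB using int_q by (intro Bochner_Integration.integral_sum[symmetric]) auto
      also have "\<dots> \<le> (\<integral>\<omega>. real C \<partial>M)"
      proof (rule integral_mono)
        show "integrable M (\<lambda>\<omega>. \<Sum>j<J. indicat_real (E C) \<omega> * q j \<omega>)"
          by (rule Bochner_Integration.integrable_sum) (rule int_q)
        show "(\<Sum>j<J. indicat_real (E C) \<omega> * q j \<omega>) \<le> real C" for \<omega>
          by (cases "\<omega> \<in> E C") (auto simp: E_def)
      qed simp
      also have "\<dots> = real C"
        by (simp add: M.prob_space)
      finally show "(\<Sum>j<J. M.prob (E C \<inter> B j)) \<le> real C" .
    qed auto
  qed (simp add: less_top[symmetric])
  then have "AE \<omega> in M. \<forall>C. \<forall>\<^sub>F j in sequentially. \<omega> \<in> space M - (E C \<inter> B j)"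
    unfolding AE_all_countable by (rule allI)
  then show ?thesis
    using q_prob AE_space
  proof eventually_elim
    case (elim \<omega>)
    show ?case
    proof
      assume "summable (\<lambda>j. measure_pmf.prob (quenched_pmf (\<lambda>i. W i \<omega>) m (n j)) (D j))"
      then have sum: "summable (\<lambda>j. q j \<omega>)" and nn: "\<And>j. 0 \<le> q j \<omega>"
        using elim(2) by simp_all
      obtain C :: nat where C: "(\<Sum>j. q j \<omega>) \<le> real C"
        using real_arch_simple by blast
      have "\<omega> \<in> E C"
        unfolding E_def using elim(3) sum_le_suminf[OF sum] nn C by (auto intro: order_trans)
      moreover have "\<forall>\<^sub>F j in sequentially. \<omega> \<in> space M - (E C \<inter> B j)"
        using elim(1) by blast
      ultimately show "\<forall>\<^sub>F j in sequentially. half_edge_targets (n j) \<omega> \<notin> D j"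
        using elim(3) by (auto simp: B_def elim: eventually_mono)
    qed
  qed
qed

section \<open>Almost sure properties of the weights\<close>

abbreviation wmean :: real where "wmean \<equiv> N.expectation V"

text \<open>Above 1 the distribution function must equal 1, and 1 is approached along a sequence;
  below 1 some larger x still has mass beyond it. The first fact feeds the upper bounds on
  generating functions and Hoeffding's inequality, the second provides the heavy weights.\<close>

lemma support_bounds:
  assumes "Sup {ereal x | x. x > 0 \<and> measure N {\<xi> \<in> space N. V \<xi> \<le> x} < 1} = 1"
  shows "AE \<xi> in N. V \<xi> \<le> 1"
    and "\<delta> > 0 \<Longrightarrow> N.prob {\<xi> \<in> space N. 1 - \<delta> < V \<xi>} > 0"
proof -
  let ?F = "\<lambda>x. N.prob {\<xi> \<in> space N. V \<xi> \<le> x}"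
  note V_measurable [measurable]
  have full: "?F x = 1" if "x > 1" for x
  proof (rule ccontr)
    assume "?F x \<noteq> 1"
    then have "?F x < 1"
      using N.prob_le_1[of "{\<xi> \<in> space N. V \<xi> \<le> x}"] by linarith
    then have "ereal x \<le> Sup {ereal x | x. x > 0 \<and> ?F x < 1}"
      using that by (intro Sup_upper) auto
    then show False
      using assms that by (simp add: one_ereal_def)
  qed
  have "AE \<xi> in N. \<forall>k. V \<xi> \<le> 1 + 1 / real (Suc k)"
  proof (subst AE_all_countable, intro allI)
    fix k
    have "?F (1 + 1 / real (Suc k)) = 1"
      by (rule full) simp
    then show "AE \<xi> in N. V \<xi> \<le> 1 + 1 / real (Suc k)"
      by (subst (asm) N.prob_Collect_eq_1) auto
  qed
  then show "AE \<xi> in N. V \<xi> \<le> 1"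
  proof eventually_elim
    case (elim \<xi>)
    show ?case
    proof (rule field_le_epsilon)
      fix e :: real assume "e > 0"
      then obtain k where "1 / real (Suc k) < e"
        using nat_approx_posE by blast
      then show "V \<xi> \<le> 1 + e"
        using elim by (meson add_left_mono less_imp_le order_trans)
    qed
  qed
  show "N.prob {\<xi> \<in> space N. 1 - \<delta> < V \<xi>} > 0" if "\<delta> > 0"
  proof -
    have "ereal (1 - \<delta>) < Sup {ereal x | x. x > 0 \<and> ?F x < 1}"
      using that unfolding assms by (simp add: one_ereal_def)
    then obtain x where x: "1 - \<delta> < x" "?F x < 1"
      by (auto simp: less_Sup_iff)
    have "?F (1 - \<delta>) \<le> ?F x"
      using x by (intro N.finite_measure_mono) auto
    moreover have "N.prob {\<xi> \<in> space N. 1 - \<delta> < V \<xi>} = 1 - ?F (1 - \<delta>)"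
      using N.prob_neg[of "\<lambda>\<xi>. V \<xi> \<le> 1 - \<delta>"] by (simp add: not_le)
    ultimately show ?thesis
      using x by simp
  qed
qed

text \<open>Stated for a function f of the weight because it is applied both to the weights and to
  the indicators of heavy weights.\<close>

lemma AE_average:
  fixes f :: "real \<Rightarrow> real"
  assumes f [measurable]: "f \<in> borel_measurable borel" and bounded: "AE \<xi> in N. f (V \<xi>) \<in> {0..1}"
  shows "AE \<omega> in M. (\<lambda>n. (\<Sum>i=1..n. f (W i \<omega>)) / real n) \<longlonglongrightarrow> N.expectation (\<lambda>\<xi>. f (V \<xi>))"
proof -
  note V_measurable [measurable]
  have "AE \<omega> in M. (\<lambda>n. (\<Sum>i=1..n. f (W i \<omega>)) / real n) \<longlonglongrightarrow> M.expectation (\<lambda>\<omega>. f (W 1 \<omega>))"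
  proof (rule M.strong_law_bounded_iid)
    show "M.indep_vars (\<lambda>_. borel) (\<lambda>i \<omega>. f (W i \<omega>)) {1..}"
      by (rule M.indep_vars_compose2[OF W_indep]) simp
    show "distr M borel (\<lambda>\<omega>. f (W i \<omega>)) = distr M borel (\<lambda>\<omega>. f (W 1 \<omega>))" if "i \<ge> 1" for i
    proof -
      have "distr M borel (\<lambda>\<omega>. f (W i \<omega>)) = distr (distr M borel (W i)) borel f"
        if "i \<ge> 1" for i
        using W_measurable[OF that] by (subst distr_distr) (auto simp: comp_def)
      then show ?thesis
        using that by (simp add: W_copies)
    qed
    show "AE \<omega> in M. f (W 1 \<omega>) \<in> {0..1}"
      using AE_W[of "\<lambda>x. f x \<in> {0..1}"] bounded by auto
  qed
  also have "M.expectation (\<lambda>\<omega>. f (W 1 \<omega>)) = integral\<^sup>L (distr M borel (W 1)) f"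
    by (rule integral_distr[symmetric]) (use W_measurable[of 1] in auto)
  also have "\<dots> = integral\<^sup>L (distr N borel V) f"
    by (simp add: W_copies)
  also have "\<dots> = N.expectation (\<lambda>\<xi>. f (V \<xi>))"
    by (rule integral_distr) auto
  finally show ?thesis .
qed

lemma wmean_pos:
  assumes "AE \<xi> in N. V \<xi> \<le> 1"
  shows "wmean > 0"
proof -
  note V_measurable [measurable]
  have "integrable N V"
    using assms V_pos by (intro N.integrable_const_bound[where B = 1]) (auto elim: eventually_elim2)
  then show ?thesis
    using N.expectation_greater[of V 0] V_pos by simp
qed

lemma AE_weight_sequence:
  assumes "Sup {ereal x | x. x > 0 \<and> measure N {\<xi> \<in> space N. V \<xi> \<le> x} < 1} = 1"
  shows "AE \<omega> in M. weight_sequence (\<lambda>i. W i \<omega>) wmean m"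
proof -
  note V_measurable [measurable]
  note bounds = support_bounds[OF assms]
  \<comment> \<open>Reciprocals in place of \<delta>, so that one null set serves all
    thresholds.\<close>
  have "AE \<omega> in M. (\<lambda>n. (\<Sum>i=1..n. indicat_real {1 - 1 / real (Suc k)<..} (W i \<omega>)) / real n) \<longlonglongrightarrow>
      N.expectation (\<lambda>\<xi>. indicat_real {1 - 1 / real (Suc k)<..} (V \<xi>))" for k
    by (rule AE_average) auto
  then have heavy: "AE \<omega> in M. \<forall>k. (\<lambda>n. (\<Sum>i=1..n. indicat_real {1 - 1 / real (Suc k)<..} (W i \<omega>)) / real n) \<longlonglongrightarrow>
      N.expectation (\<lambda>\<xi>. indicat_real {1 - 1 / real (Suc k)<..} (V \<xi>))"
    by (simp add: AE_all_countable)
  have "AE \<omega> in M. (\<lambda>n. (\<Sum>i=1..n. W i \<omega>) / real n) \<longlonglongrightarrow> wmean"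
    using bounds(1) V_pos by (intro AE_average[of "\<lambda>x. x"]) (auto elim: eventually_elim2)
  moreover have "AE \<omega> in M. \<forall>i\<ge>1. W i \<omega> > 0"
    using V_pos by (intro AE_W) auto
  moreover have "AE \<omega> in M. \<forall>i\<ge>1. W i \<omega> \<le> 1"
    using bounds(1) by (intro AE_W) auto
  ultimately show ?thesis
    using heavy
  proof eventually_elim
    case (elim \<omega>)
    show ?case
    proof
      fix \<delta> :: real assume "\<delta> > 0"
      then obtain k where k: "1 / real (Suc k) < \<delta>"
        using nat_approx_posE by blast
      define p where "p = N.expectation (\<lambda>\<xi>. indicat_real {1 - 1 / real (Suc k)<..} (V \<xi>))"
      have "p = N.expectation (indicat_real {\<xi> \<in> space N. 1 - 1 / real (Suc k) < V \<xi>})"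
        unfolding p_def by (intro Bochner_Integration.integral_cong) (auto simp: indicator_def)
      then have "p > 0"
        using bounds(2)[of "1 / real (Suc k)"] by simp
      \<comment> \<open>The constant is half of the limiting proportion of weights above 1 - 1 / (k
        + 1), all of which exceed 1 - \<delta>.\<close>
      have "\<forall>\<^sub>F n in sequentially. p / 2 < (\<Sum>i=1..n. indicat_real {1 - 1 / real (Suc k)<..} (W i \<omega>)) / real n"
        using elim(4) \<open>p > 0\<close> unfolding p_def[symmetric]
        by (intro order_tendstoD[where y = p]) (auto simp: p_def)
      then have "\<forall>\<^sub>F n in sequentially. p / 2 * real n \<le> real (card {i \<in> {1..n}. 1 - \<delta> < W i \<omega>})"
        using eventually_gt_at_top[of 0]
      proof eventually_elim
        case (elim n)
        have "p / 2 * real n \<le> (\<Sum>i=1..n. indicat_real {1 - 1 / real (Suc k)<..} (W i \<omega>))"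
          using elim by (simp add: less_divide_eq)
        also have "\<dots> \<le> (\<Sum>i=1..n. of_bool (1 - \<delta> < W i \<omega>))"
          using k by (intro sum_mono) (auto simp: indicator_def)
        also have "\<dots> = real (card {i \<in> {1..n}. 1 - \<delta> < W i \<omega>})"
          by (simp add: sum_of_bool_eq Int_def)
        finally show ?case .
      qed
      then show "\<exists>c>0. \<forall>\<^sub>F n in sequentially. c * real n \<le> real (card {i \<in> {1..n}. 1 - \<delta> < W i \<omega>})"
        using \<open>p > 0\<close> by (intro exI[of _ "p / 2"]) auto
    qed (use elim m_pos wmean_pos[OF bounds(1)] in auto)
  qed
qed

end

theorem theorem2p3:
  fixes M :: "'a measure" and N :: "'b measure" and V :: "'b \<Rightarrow> real" and m :: nat
    and W :: "nat \<Rightarrow> 'a \<Rightarrow> real" and X :: "nat \<Rightarrow> nat \<Rightarrow> 'a \<Rightarrow> nat"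
  assumes "weighted_recursive_graph M N V m W X"
    and "Sup {ereal x | x. x > 0 \<and> measure N {\<xi> \<in> space N. V \<xi> \<le> x} < 1} = 1"
  shows "AE \<omega> in M.
    (\<lambda>n. ln (real (max_degree_label m X n \<omega>)) / ln (real n)) \<longlonglongrightarrow> weight_mu N V m"
proof -
  interpret weighted_recursive_graph M N V m W X by fact
  \<comment> \<open>Region and level depend on the weights only through \<open>wmean\<close> and m,
    so the events below do not vary with \<omega>.\<close>
  define R where "R = weight_sequence.region wmean m"
  define L where "L = weight_sequence.level wmean m"
  define high where "high \<beta> k j =
    {x :: nat \<times> nat \<Rightarrow> nat. \<exists>i\<in>R \<beta> (2 ^ j). L (1 / real (Suc k)) (2 ^ j) \<le> real (count_label (half_edges m (2 ^ j)) x i)}" for \<beta> k j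
  define low where "low k j =
    {x :: nat \<times> nat \<Rightarrow> nat. \<forall>i\<in>{1..2 ^ j}. real (count_label (half_edges m (2 ^ j)) x i) < L (1 / real (Suc (Suc k))) (2 ^ j)}" for k j
  \<comment> \<open>Summability stands inside the almost sure statement: it is established for a
    given weight sequence, and so is the choice of the k that works for \<beta>.\<close>
  have "AE \<omega> in M. \<forall>\<beta>\<in>\<rat>. \<forall>k.
      summable (\<lambda>j. measure_pmf.prob (quenched_pmf (\<lambda>i. W i \<omega>) m (2 ^ j)) (high \<beta> k j)) \<longrightarrow>
      (\<forall>\<^sub>F j in sequentially. half_edge_targets (2 ^ j) \<omega> \<notin> high \<beta> k j)"
    unfolding AE_ball_countable[OF countable_rat] AE_all_countable
    by (intro ballI allI quenched_borel_cantelli) simp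
  moreover have "AE \<omega> in M. \<forall>k.
      summable (\<lambda>j. measure_pmf.prob (quenched_pmf (\<lambda>i. W i \<omega>) m (2 ^ j)) (low k j)) \<longrightarrow>
      (\<forall>\<^sub>F j in sequentially. half_edge_targets (2 ^ j) \<omega> \<notin> low k j)"
    unfolding AE_all_countable by (intro allI quenched_borel_cantelli) simp
  ultimately show ?thesis
    using AE_weight_sequence[OF assms(2)]
  proof eventually_elim
    case (elim \<omega>)
    interpret weight_sequence "\<lambda>i. W i \<omega>" wmean m
      by (fact elim(3))
    define d where "d n i = in_degree (wrg_graph m X n \<omega>) i" for n i
    have d_eq: "d n i = count_label (half_edges m n) (half_edge_targets n \<omega>) i" for n i
      unfolding d_def in_degree_wrg_graph count_label_def
      by (rule arg_cong[where f = card]) (auto simp: half_edge_targets_def)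
    have "(\<lambda>n. ln (real (max_degree_label m X n \<omega>)) / ln (real n)) \<longlonglongrightarrow> \<mu>"
    proof (rule ratio_of_maximizer_tendsto[where d = d])
      show "d n i \<le> d n' i" if "n \<le> n'" for n n' i
        unfolding d_def in_degree_wrg_graph
        using that by (intro card_mono finite_subset[OF _ finite_half_edges]) (auto simp: half_edges_def)
      show "max_degree_label m X n \<omega> \<in> {1..n}" if "n \<ge> 1" for n
        by (rule max_degree_label_maximizes(1)[OF that])
      show "d n i \<le> d n (max_degree_label m X n \<omega>)" if "i \<in> {1..n}" for n i
        unfolding d_def using that by (intro max_degree_label_maximizes(2)) auto
    next
      fix \<beta> assume \<beta>: "\<beta> \<in> \<rat>" "\<beta> \<noteq> \<mu>"
      obtain k where "summable (\<lambda>j. measure_pmf.prob (quenched_pmf (\<lambda>i. W i \<omega>) m (2 ^ j)) (high \<beta> k j))"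
        using summable_prob_high_degree_in_region_reciprocal[OF \<beta>(2)] unfolding high_def R_def L_def by blast
      then have "\<forall>\<^sub>F j in sequentially. half_edge_targets (2 ^ j) \<omega> \<notin> high \<beta> k j"
        using elim(1) \<beta>(1) by blast
      then show "\<exists>k. \<forall>\<^sub>F j in sequentially.
          \<forall>i\<in>region \<beta> (2 ^ j). real (d (2 ^ j) i) < level (1 / real (Suc k)) (2 ^ j)"
        by (intro exI[of _ k]) (auto simp: high_def R_def L_def d_eq not_le elim: eventually_mono)
    next
      fix k
      have "summable (\<lambda>j. measure_pmf.prob (quenched_pmf (\<lambda>i. W i \<omega>) m (2 ^ j)) (low k j))"
        unfolding low_def L_def by (rule summable_prob_all_degrees_low) simp_all
      then have "\<forall>\<^sub>F j in sequentially. half_edge_targets (2 ^ j) \<omega> \<notin> low k j"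
        using elim(2) by blast
      then show "\<forall>\<^sub>F j in sequentially.
          \<exists>i\<in>{1..2 ^ j}. level (1 / real (Suc (Suc k))) (2 ^ j) \<le> real (d (2 ^ j) i)"
        by eventually_elim (auto simp: low_def L_def d_eq not_less)
    qed
    also have "\<mu> = weight_mu N V m"
      by (simp add: \<mu>_def \<theta>_def weight_mu_def weight_theta_def)
    finally show ?case .
  qed
qed

end
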